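(* Let $(M,g,\nabla,\nabla^{*})$ be a statistical manifold, with $\nabla^*$ the $g$-dual connection of $\nabla$, and let $G_{ij}:=R_{(ij)}-\frac12 g_{ij}R$ and $G^*_{ij}:=R^*_{(ij)}-\frac12 g_{ij}R^*$ be the Einstein tensors of $\nabla$ and $\nabla^*$. Then, in any local coordinates, $$\nabla^iG_{ij}=-\tfrac12\Big\{\nabla^i(R^*_{ij}-R_{ji})+(\nabla^ig_{ij})R+(\nabla_hg^{ls})R_{l\ sj}^{\ h}+(\nabla_jg^{ls})R_{ls}+(\nabla_hg^{hs})R^*_{sj}\Big\},$$ $$\nabla^{*i}G^*_{ij}=-\tfrac12\Big\{\nabla^{*i}(R_{ij}-R^*_{ji})+(\nabla^{*i}g_{ij})R^*+(\nabla^*_hg^{ls})R^{*\ h}_{\ l\ sj}+(\nabla^*_jg^{ls})R^*_{ls}+(\nabla^*_hg^{hs})R_{sj}\Big\},$$ $$\nabla^{*i}G_{ij}=\nabla^{*i}R_{(ij)}-\tfrac12(\nabla^{*i}g_{ij})R-\tfrac12\nabla^*_jR,$$ $$\nabla^{i}G^*_{ij}=\nabla^{i}R^*_{(ij)}-\tfrac12(\nabla^{i}g_{ij})R^*-\tfrac12\nabla_jR^*.$$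
   Context: $(M,g)$ is a (pseudo-)Riemannian manifold and $\nabla$ an affine connection on it. The $g$-dual connection $\nabla^*$ is the affine connection determined by $X(g(Y,Z))=g(\nabla_XY,Z)+g(Y,\nabla^*_XZ)$. The triple $(M,g,\nabla)$ is a statistical manifold if $\nabla$ and $\nabla^*$ are both torsion-free (torsion: $T(X,Y)=\nabla_XY-\nabla_YX-[X,Y]$). The curvature is $R(X,Y)Z=\nabla_X\nabla_YZ-\nabla_Y\nabla_XZ-\nabla_{[X,Y]}Z$, with components $R(\partial_k,\partial_l)\partial_i=R_{i\ kl}^{\ j}\partial_j$; the Ricci tensor is $R_{ij}=R_{i\ kj}^{\ k}$ (sum over $k$), its symmetrization $R_{(ij)}=\frac12(R_{ij}+R_{ji})$, and the Ricci scalar $R=g^{ij}R_{ij}$. Starred quantities $R^{*\ j}_{\ i\ kl}, R^*_{ij},R^*$ are the same objects for $\nabla^*$ (traces also taken with $g$). $g^{ij}$ is the inverse metric, viewed as a $(2,0)$-tensor. $\nabla_k$ denotes covariant derivative along $\partial_k$ of the tensor with the displayed components, $\nabla^i:=g^{is}\nabla_s$, $\nabla^{*i}:=g^{is}\nabla^*_s$ (index raised after differentiation). Summation over repeated indices is understood. *)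

theory Defs
  imports "HOL-Analysis.Analysis"
begin

text \<open>A manifold is a Hausdorff second countable type \<open>'m\<close> with a maximal smooth atlas; its
  dimension is \<open>CARD('n)\<close>. A chart is a pair \<open>(U, \<phi>)\<close>; the values of \<open>\<phi>\<close> outside \<open>U\<close> are
  irrelevant.\<close>

primrec Ck_on :: "nat \<Rightarrow> 'a::euclidean_space set \<Rightarrow> ('a \<Rightarrow> 'b::real_normed_vector) \<Rightarrow> bool" where
  "Ck_on 0 S f \<longleftrightarrow> continuous_on S f"
| "Ck_on (Suc k) S f \<longleftrightarrow> (\<forall>x\<in>S. f differentiable (at x)) \<and>
     (\<forall>v. Ck_on k S (\<lambda>x. frechet_derivative f (at x) v))"

text \<open>The recursion uses two-sided derivatives and is only meant for open \<open>S\<close>.\<close>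

definition Cinf_on :: "'a::euclidean_space set \<Rightarrow> ('a \<Rightarrow> 'b::real_normed_vector) \<Rightarrow> bool" where
  "Cinf_on S f \<longleftrightarrow> (\<forall>k. Ck_on k S f)"

type_synonym ('m, 'n) chart = "'m set \<times> ('m \<Rightarrow> real ^ 'n)"

abbreviation dom_chart :: "('m, 'n) chart \<Rightarrow> 'm set" where
  "dom_chart c \<equiv> fst c"

abbreviation inv_chart :: "('m, 'n) chart \<Rightarrow> real ^ 'n \<Rightarrow> 'm" where
  "inv_chart c \<equiv> inv_into (fst c) (snd c)"

definition is_chart :: "('m::topological_space, 'n::finite) chart \<Rightarrow> bool" where
  "is_chart c \<longleftrightarrow> open (dom_chart c) \<and> open (snd c ` dom_chart c) \<and>
     homeomorphism (dom_chart c) (snd c ` dom_chart c) (snd c) (inv_chart c)"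

definition compatible :: "('m, 'n::finite) chart \<Rightarrow> ('m, 'n) chart \<Rightarrow> bool" where
  "compatible c d \<longleftrightarrow>
     Cinf_on (snd c ` (dom_chart c \<inter> dom_chart d)) (snd d \<circ> inv_chart c) \<and>
     Cinf_on (snd d ` (dom_chart c \<inter> dom_chart d)) (snd c \<circ> inv_chart d)"

definition smooth_structure ::
  "('m::{t2_space, second_countable_topology}, 'n::finite) chart set \<Rightarrow> bool" where
  "smooth_structure A \<longleftrightarrow>
     (\<forall>c\<in>A. is_chart c) \<and> (\<Union>c\<in>A. dom_chart c) = UNIV \<and>
     (\<forall>c\<in>A. \<forall>d\<in>A. compatible c d) \<and>
     (\<forall>c. is_chart c \<and> (\<forall>d\<in>A. compatible c d) \<longrightarrow> c \<in> A)"

definition smooth_fun_on ::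
  "('m::topological_space, 'n::finite) chart set \<Rightarrow> 'm set \<Rightarrow> ('m \<Rightarrow> real) \<Rightarrow> bool" where
  "smooth_fun_on A W f \<longleftrightarrow> (\<forall>c\<in>A. Cinf_on (snd c ` (dom_chart c \<inter> W)) (f \<circ> inv_chart c))"

definition smooth_near ::
  "('m::topological_space, 'n::finite) chart set \<Rightarrow> 'm \<Rightarrow> ('m \<Rightarrow> real) \<Rightarrow> bool" where
  "smooth_near A p f \<longleftrightarrow> (\<exists>W. open W \<and> p \<in> W \<and> smooth_fun_on A W f)"

text \<open>A tangent vector at \<open>p\<close> is the directional derivative functional on the functions that are
  smooth near \<open>p\<close>. It takes the value 0 on all other functions, so that equality of tangent
  vectors is equality of HOL functions.\<close>

type_synonym 'm tvec = "('m \<Rightarrow> real) \<Rightarrow> real"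
type_synonym 'm vfield = "'m \<Rightarrow> 'm tvec"

definition dir_deriv :: "('m::topological_space, 'n::finite) chart set \<Rightarrow> ('m, 'n) chart \<Rightarrow>
    real ^ 'n \<Rightarrow> 'm vfield" where
  "dir_deriv A c a p f =
     (if smooth_near A p f then frechet_derivative (f \<circ> inv_chart c) (at (snd c p)) a else 0)"

definition tangent_space ::
  "('m::topological_space, 'n::finite) chart set \<Rightarrow> 'm \<Rightarrow> 'm tvec set" where
  "tangent_space A p = {dir_deriv A c a p | c a. c \<in> A \<and> p \<in> dom_chart c}"

definition smooth_field_on ::
  "('m::topological_space, 'n::finite) chart set \<Rightarrow> 'm set \<Rightarrow> 'm vfield \<Rightarrow> bool" where
  "smooth_field_on A W X \<longleftrightarrow> (\<forall>p\<in>W. X p \<in> tangent_space A p) \<and>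
     (\<forall>V f. open V \<and> V \<subseteq> W \<and> smooth_fun_on A V f \<longrightarrow> smooth_fun_on A V (\<lambda>p. X p f))"

definition add_field :: "'m vfield \<Rightarrow> 'm vfield \<Rightarrow> 'm vfield" where
  "add_field X Y = (\<lambda>p f. X p f + Y p f)"

definition scale_field :: "('m \<Rightarrow> real) \<Rightarrow> 'm vfield \<Rightarrow> 'm vfield" where
  "scale_field h X = (\<lambda>p f. h p * X p f)"

definition lie_bracket :: "('m::topological_space, 'n::finite) chart set \<Rightarrow>
    'm vfield \<Rightarrow> 'm vfield \<Rightarrow> 'm vfield" where
  "lie_bracket A X Y = (\<lambda>p f.
     if smooth_near A p f then X p (\<lambda>q. Y q f) - Y p (\<lambda>q. X q f) else 0)"

definition pseudo_riemannian_metric :: "('m::topological_space, 'n::finite) chart set \<Rightarrow>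
    ('m \<Rightarrow> 'm tvec \<Rightarrow> 'm tvec \<Rightarrow> real) \<Rightarrow> bool" where
  "pseudo_riemannian_metric A g \<longleftrightarrow>
     (\<forall>p. \<forall>u\<in>tangent_space A p. \<forall>v\<in>tangent_space A p. \<forall>w\<in>tangent_space A p. \<forall>r.
        g p (\<lambda>f. u f + v f) w = g p u w + g p v w \<and>
        g p (\<lambda>f. r * u f) w = r * g p u w \<and>
        g p u w = g p w u) \<and>
     (\<forall>p. \<forall>u\<in>tangent_space A p. (\<forall>v\<in>tangent_space A p. g p u v = 0) \<longrightarrow> u = (\<lambda>f. 0)) \<and>
     (\<forall>W X Y. open W \<and> smooth_field_on A W X \<and> smooth_field_on A W Y \<longrightarrow>
        smooth_fun_on A W (\<lambda>p. g p (X p) (Y p)))"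

text \<open>As usual, a connection is applied to vector fields that are only defined on an open set
  \<open>W\<close>, such as coordinate fields. Hence the axioms are stated over every open \<open>W\<close>, and the last
  one says that the operators over different open sets are compatible with restriction.\<close>

definition affine_connection :: "('m::topological_space, 'n::finite) chart set \<Rightarrow>
    ('m vfield \<Rightarrow> 'm vfield \<Rightarrow> 'm vfield) \<Rightarrow> bool" where
  "affine_connection A D \<longleftrightarrow> (\<forall>W X X' Y Y' h. open W \<and>
     smooth_field_on A W X \<and> smooth_field_on A W X' \<and>
     smooth_field_on A W Y \<and> smooth_field_on A W Y' \<and> smooth_fun_on A W h \<longrightarrow>
       smooth_field_on A W (D X Y) \<and>
       (\<forall>p\<in>W. D (add_field X X') Y p = add_field (D X Y) (D X' Y) p) \<and>
       (\<forall>p\<in>W. D (scale_field h X) Y p = scale_field h (D X Y) p) \<and>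
       (\<forall>p\<in>W. D X (add_field Y Y') p = add_field (D X Y) (D X Y') p) \<and>
       (\<forall>p\<in>W. D X (scale_field h Y) p =
          add_field (scale_field (\<lambda>q. X q h) Y) (scale_field h (D X Y)) p) \<and>
       ((\<forall>p\<in>W. X p = X' p) \<and> (\<forall>p\<in>W. Y p = Y' p) \<longrightarrow> (\<forall>p\<in>W. D X Y p = D X' Y' p)))"

definition dual_connection :: "('m::topological_space, 'n::finite) chart set \<Rightarrow>
    ('m \<Rightarrow> 'm tvec \<Rightarrow> 'm tvec \<Rightarrow> real) \<Rightarrow> ('m vfield \<Rightarrow> 'm vfield \<Rightarrow> 'm vfield) \<Rightarrow>
    ('m vfield \<Rightarrow> 'm vfield \<Rightarrow> 'm vfield) \<Rightarrow> bool" where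
  "dual_connection A g D Ds \<longleftrightarrow> affine_connection A Ds \<and>
     (\<forall>W X Y Z. open W \<and>
        smooth_field_on A W X \<and> smooth_field_on A W Y \<and> smooth_field_on A W Z \<longrightarrow>
        (\<forall>p\<in>W. X p (\<lambda>q. g q (Y q) (Z q)) = g p (D X Y p) (Z p) + g p (Y p) (Ds X Z p)))"

definition torsion :: "('m::topological_space, 'n::finite) chart set \<Rightarrow>
    ('m vfield \<Rightarrow> 'm vfield \<Rightarrow> 'm vfield) \<Rightarrow> 'm vfield \<Rightarrow> 'm vfield \<Rightarrow> 'm vfield" where
  "torsion A D X Y = (\<lambda>p f. D X Y p f - D Y X p f - lie_bracket A X Y p f)"

definition torsion_free :: "('m::topological_space, 'n::finite) chart set \<Rightarrow>
    ('m vfield \<Rightarrow> 'm vfield \<Rightarrow> 'm vfield) \<Rightarrow> bool" where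
  "torsion_free A D \<longleftrightarrow> (\<forall>W X Y. open W \<and> smooth_field_on A W X \<and> smooth_field_on A W Y \<longrightarrow>
     (\<forall>p\<in>W. torsion A D X Y p = (\<lambda>f. 0)))"

definition statistical_manifold ::
  "('m::{t2_space, second_countable_topology}, 'n::finite) chart set \<Rightarrow>
    ('m \<Rightarrow> 'm tvec \<Rightarrow> 'm tvec \<Rightarrow> real) \<Rightarrow> ('m vfield \<Rightarrow> 'm vfield \<Rightarrow> 'm vfield) \<Rightarrow>
    ('m vfield \<Rightarrow> 'm vfield \<Rightarrow> 'm vfield) \<Rightarrow> bool" where
  "statistical_manifold A g D Ds \<longleftrightarrow> smooth_structure A \<and> pseudo_riemannian_metric A g \<and>
     affine_connection A D \<and> dual_connection A g D Ds \<and> torsion_free A D \<and> torsion_free A Ds"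

definition curvature :: "('m::topological_space, 'n::finite) chart set \<Rightarrow>
    ('m vfield \<Rightarrow> 'm vfield \<Rightarrow> 'm vfield) \<Rightarrow>
    'm vfield \<Rightarrow> 'm vfield \<Rightarrow> 'm vfield \<Rightarrow> 'm vfield" where
  "curvature A D X Y Z = (\<lambda>p f.
     D X (D Y Z) p f - D Y (D X Z) p f - D (lie_bracket A X Y) Z p f)"

text \<open>All components below are functions on the manifold, meaningful on the domain of the
  chart \<open>c\<close>. Indices are listed from left to right as in the index notation.\<close>

definition coord_field :: "('m::topological_space, 'n::finite) chart set \<Rightarrow> ('m, 'n) chart \<Rightarrow>
    'n \<Rightarrow> 'm vfield" where
  "coord_field A c k = dir_deriv A c (axis k 1)"

text \<open>The \<open>j\<close>-th component of a tangent vector \<open>v\<close> is \<open>v(x\<^sup>j)\<close>, where \<open>x\<^sup>j\<close> is the \<open>j\<close>-th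
  coordinate function.\<close>

definition component :: "('m, 'n::finite) chart \<Rightarrow> 'n \<Rightarrow> 'm tvec \<Rightarrow> real" where
  "component c j v = v (\<lambda>q. snd c q $ j)"

text \<open>\<open>christoffel A c D k i j\<close> is the \<open>k\<close>-th component of \<open>\<nabla>\<^bsub>\<partial>\<^sub>i\<^esub> \<partial>\<^sub>j\<close>.\<close>

definition christoffel :: "('m::topological_space, 'n::finite) chart set \<Rightarrow> ('m, 'n) chart \<Rightarrow>
    ('m vfield \<Rightarrow> 'm vfield \<Rightarrow> 'm vfield) \<Rightarrow> 'n \<Rightarrow> 'n \<Rightarrow> 'n \<Rightarrow> 'm \<Rightarrow> real" where
  "christoffel A c D k i j p = component c k (D (coord_field A c i) (coord_field A c j) p)"

definition metric_comp :: "('m::topological_space, 'n::finite) chart set \<Rightarrow> ('m, 'n) chart \<Rightarrow>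
    ('m \<Rightarrow> 'm tvec \<Rightarrow> 'm tvec \<Rightarrow> real) \<Rightarrow> 'n \<Rightarrow> 'n \<Rightarrow> 'm \<Rightarrow> real" where
  "metric_comp A c g i j p = g p (coord_field A c i p) (coord_field A c j p)"

definition inv_metric_comp :: "('m::topological_space, 'n::finite) chart set \<Rightarrow>
    ('m, 'n) chart \<Rightarrow> ('m \<Rightarrow> 'm tvec \<Rightarrow> 'm tvec \<Rightarrow> real) \<Rightarrow> 'n \<Rightarrow> 'n \<Rightarrow> 'm \<Rightarrow> real" where
  "inv_metric_comp A c g i j p = matrix_inv (\<chi> a b. metric_comp A c g a b p) $ i $ j"

text \<open>\<open>curv_comp A c D i j k l\<close> is the coefficient of \<open>\<partial>\<^sub>j\<close> in \<open>R(\<partial>\<^sub>k, \<partial>\<^sub>l) \<partial>\<^sub>i\<close>.\<close>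

definition curv_comp :: "('m::topological_space, 'n::finite) chart set \<Rightarrow> ('m, 'n) chart \<Rightarrow>
    ('m vfield \<Rightarrow> 'm vfield \<Rightarrow> 'm vfield) \<Rightarrow> 'n \<Rightarrow> 'n \<Rightarrow> 'n \<Rightarrow> 'n \<Rightarrow> 'm \<Rightarrow> real" where
  "curv_comp A c D i j k l p = component c j
     (curvature A D (coord_field A c k) (coord_field A c l) (coord_field A c i) p)"

definition ricci :: "('m::topological_space, 'n::finite) chart set \<Rightarrow> ('m, 'n) chart \<Rightarrow>
    ('m vfield \<Rightarrow> 'm vfield \<Rightarrow> 'm vfield) \<Rightarrow> 'n \<Rightarrow> 'n \<Rightarrow> 'm \<Rightarrow> real" where
  "ricci A c D i j p = (\<Sum>k\<in>UNIV. curv_comp A c D i k k j p)"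

definition ricci_sym :: "('m::topological_space, 'n::finite) chart set \<Rightarrow> ('m, 'n) chart \<Rightarrow>
    ('m vfield \<Rightarrow> 'm vfield \<Rightarrow> 'm vfield) \<Rightarrow> 'n \<Rightarrow> 'n \<Rightarrow> 'm \<Rightarrow> real" where
  "ricci_sym A c D i j p = 1/2 * (ricci A c D i j p + ricci A c D j i p)"

definition ricci_scalar :: "('m::topological_space, 'n::finite) chart set \<Rightarrow> ('m, 'n) chart \<Rightarrow>
    ('m \<Rightarrow> 'm tvec \<Rightarrow> 'm tvec \<Rightarrow> real) \<Rightarrow> ('m vfield \<Rightarrow> 'm vfield \<Rightarrow> 'm vfield) \<Rightarrow>
    'm \<Rightarrow> real" where
  "ricci_scalar A c g D p =
     (\<Sum>i\<in>UNIV. \<Sum>j\<in>UNIV. inv_metric_comp A c g i j p * ricci A c D i j p)"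

definition einstein :: "('m::topological_space, 'n::finite) chart set \<Rightarrow> ('m, 'n) chart \<Rightarrow>
    ('m \<Rightarrow> 'm tvec \<Rightarrow> 'm tvec \<Rightarrow> real) \<Rightarrow> ('m vfield \<Rightarrow> 'm vfield \<Rightarrow> 'm vfield) \<Rightarrow>
    'n \<Rightarrow> 'n \<Rightarrow> 'm \<Rightarrow> real" where
  "einstein A c g D i j p =
     ricci_sym A c D i j p - 1/2 * metric_comp A c g i j p * ricci_scalar A c g D p"

text \<open>Covariant derivatives along \<open>\<partial>\<^sub>k\<close> of the scalar \<open>f\<close>, of the (0,2)-tensor with components
  \<open>T i j\<close> and of the (2,0)-tensor with components \<open>T i j\<close>, followed by the derivative
  \<open>\<nabla>\<^sup>a = g\<^sup>a\<^sup>s \<nabla>\<^sub>s\<close> of a (0,2)-tensor.\<close>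

definition nabla_scalar :: "('m::topological_space, 'n::finite) chart set \<Rightarrow> ('m, 'n) chart \<Rightarrow>
    'n \<Rightarrow> ('m \<Rightarrow> real) \<Rightarrow> 'm \<Rightarrow> real" where
  "nabla_scalar A c k f p = coord_field A c k p f"

definition nabla_cov :: "('m::topological_space, 'n::finite) chart set \<Rightarrow> ('m, 'n) chart \<Rightarrow>
    ('m vfield \<Rightarrow> 'm vfield \<Rightarrow> 'm vfield) \<Rightarrow> 'n \<Rightarrow> ('n \<Rightarrow> 'n \<Rightarrow> 'm \<Rightarrow> real) \<Rightarrow>
    'n \<Rightarrow> 'n \<Rightarrow> 'm \<Rightarrow> real" where
  "nabla_cov A c D k T i j p = coord_field A c k p (T i j)
     - (\<Sum>s\<in>UNIV. christoffel A c D s k i p * T s j p)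
     - (\<Sum>s\<in>UNIV. christoffel A c D s k j p * T i s p)"

definition nabla_con :: "('m::topological_space, 'n::finite) chart set \<Rightarrow> ('m, 'n) chart \<Rightarrow>
    ('m vfield \<Rightarrow> 'm vfield \<Rightarrow> 'm vfield) \<Rightarrow> 'n \<Rightarrow> ('n \<Rightarrow> 'n \<Rightarrow> 'm \<Rightarrow> real) \<Rightarrow>
    'n \<Rightarrow> 'n \<Rightarrow> 'm \<Rightarrow> real" where
  "nabla_con A c D k T i j p = coord_field A c k p (T i j)
     + (\<Sum>s\<in>UNIV. christoffel A c D i k s p * T s j p)
     + (\<Sum>s\<in>UNIV. christoffel A c D j k s p * T i s p)"

definition nabla_up :: "('m::topological_space, 'n::finite) chart set \<Rightarrow> ('m, 'n) chart \<Rightarrow>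
    ('m \<Rightarrow> 'm tvec \<Rightarrow> 'm tvec \<Rightarrow> real) \<Rightarrow> ('m vfield \<Rightarrow> 'm vfield \<Rightarrow> 'm vfield) \<Rightarrow>
    'n \<Rightarrow> ('n \<Rightarrow> 'n \<Rightarrow> 'm \<Rightarrow> real) \<Rightarrow> 'n \<Rightarrow> 'n \<Rightarrow> 'm \<Rightarrow> real" where
  "nabla_up A c g D a T i j p =
     (\<Sum>s\<in>UNIV. inv_metric_comp A c g a s p * nabla_cov A c D s T i j p)"

end

theory Submission
  imports Defs
begin

text \<open>Two classical facts carry the proof.

  The first is the second Bianchi identity for the torsion-free connection \<open>\<nabla>\<close>. Contracting it
  once gives \<open>\<nabla>\<^sub>j R\<^sub>i\<^sub>l = \<nabla>\<^sub>l R\<^sub>i\<^sub>j - \<nabla>\<^sub>h R\<^sub>i\<^sup>h\<^sub>l\<^sub>j\<close> (lemma \<open>contracted_bianchi\<close>). A second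
  contraction, with \<open>g\<^sup>i\<^sup>l\<close>, turns the left-hand side into the derivative of the Ricci scalar.
  Since \<open>\<nabla>g\<close> need not vanish, each product rule that moves the inverse metric past \<open>\<nabla>\<close> leaves
  behind a term with a derivative of the inverse metric.

  The second is the duality \<open>g (R(X, Y) Z, W) = - g (Z, R\<^sup>*(X, Y) W)\<close>, obtained by
  differentiating the metric twice (lemma \<open>curvature_duality_matrix\<close>). Hence
  \<open>g\<^sup>i\<^sup>l R\<^sub>i\<^sup>h\<^sub>l\<^sub>j = - g\<^sup>h\<^sup>s R\<^sup>*\<^sub>s\<^sub>j\<close> (lemma \<open>curvature_trace_duality\<close>), so the divergence of
  this contraction of the curvature is a divergence of the Ricci tensor of the dual connection.
  Together they express \<open>\<partial>\<^sub>j R\<close> by the divergences of \<open>R\<^sub>i\<^sub>j\<close> and \<open>R\<^sup>*\<^sub>i\<^sub>j\<close> and three terms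
  with derivatives of the inverse metric (lemma \<open>partial_ricci_scalar\<close>).

  The product rule gives the divergence of the Einstein tensor with respect to either connection in
  terms of \<open>\<partial>\<^sub>j R\<close> (lemma \<open>divergence_einstein\<close>). This is already the content of the two mixed
  equations, and inserting the formula for \<open>\<partial>\<^sub>j R\<close> gives the first equation. The second one is
  the first with the roles of \<open>\<nabla>\<close> and \<open>\<nabla>\<^sup>*\<close> exchanged, as duality is a symmetric relation.

  To compute with components at all, one needs that they are smooth, that the coordinate fields act
  on smooth functions as commuting derivations, and that a connection is given by its Christoffel
  symbols. Commutation is read off from the torsion-free connection itself (lemma
  \<open>coordinate_bracket\<close>) instead of being proved by analysis.\<close>


section \<open>Smooth functions on open sets\<close>

text \<open>The derivatives are two-sided, so they depend only on the values in \<open>S\<close> because \<open>S\<close> is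
  open.\<close>

lemma Ck_on_cong:
  assumes "open S" "\<And>x. x \<in> S \<Longrightarrow> f x = g x"
  shows "Ck_on k S f \<longleftrightarrow> Ck_on k S g"
  using assms(2)
proof (induction k arbitrary: f g)
  case 0
  then show ?case by (simp cong: continuous_on_cong)
next
  case (Suc k)
  have diff: "f differentiable (at x) \<longleftrightarrow> g differentiable (at x)" if "x \<in> S" for x
    unfolding differentiable_def
    using has_derivative_transform_within_open[OF _ assms(1) that, of f]
      has_derivative_transform_within_open[OF _ assms(1) that, of g] Suc.prems by metis
  show ?case
  proof (cases "\<forall>x\<in>S. f differentiable (at x)")
    case True
    have "Ck_on k S (\<lambda>x. frechet_derivative f (at x) v)
        \<longleftrightarrow> Ck_on k S (\<lambda>x. frechet_derivative g (at x) v)" for v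
    proof (rule Suc.IH)
      fix x assume x: "x \<in> S"
      show "frechet_derivative f (at x) v = frechet_derivative g (at x) v"
        using frechet_derivative_transform_within_open[of f x S g] True assms(1) x Suc.prems
        by simp
    qed
    with diff show ?thesis by simp
  next
    case False
    with diff show ?thesis by auto
  qed
qed

lemma Ck_on_SucI:
  assumes "open S" "\<And>x. x \<in> S \<Longrightarrow> (f has_derivative f' x) (at x)"
    and "\<And>v. Ck_on k S (\<lambda>x. f' x v)"
  shows "Ck_on (Suc k) S f"
proof -
  have eq: "frechet_derivative f (at x) = f' x" if "x \<in> S" for x
    using frechet_derivative_at[OF assms(2)[OF that]] by simp
  have "Ck_on k S (\<lambda>x. frechet_derivative f (at x) v)" for v
    using assms(3)[of v] Ck_on_cong[OF assms(1), of "\<lambda>x. frechet_derivative f (at x) v"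
        "\<lambda>x. f' x v"] eq by simp
  then show ?thesis
    using differentiableI[OF assms(2)] by simp
qed

text \<open>The derivative of a product or of a composition contains the given functions themselves
  besides their derivatives. Inductions on the order therefore need that the classes decrease.\<close>

lemma Ck_on_SucD:
  assumes "Ck_on (Suc k) S f"
  shows "Ck_on k S f"
  using assms
proof (induction k arbitrary: f)
  case 0
  then have "\<forall>x\<in>S. f differentiable (at x)"
    unfolding Ck_on.simps(2)[of 0] by blast
  then have "f differentiable_on S"
    by (intro differentiable_at_imp_differentiable_on) blast
  then show ?case unfolding Ck_on.simps(1) by (rule differentiable_imp_continuous_on)
next
  case (Suc k)
  from Suc.prems have "\<forall>x\<in>S. f differentiable (at x)"
    and "\<And>v. Ck_on (Suc k) S (\<lambda>x. frechet_derivative f (at x) v)"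
    unfolding Ck_on.simps(2)[of "Suc k"] by blast+
  with Suc.IH show ?case unfolding Ck_on.simps(2)[of k] by blast
qed

lemma Ck_on_subset: "Ck_on k S f \<Longrightarrow> T \<subseteq> S \<Longrightarrow> Ck_on k T f"
proof (induction k arbitrary: f)
  case 0
  then show ?case using continuous_on_subset by auto
next
  case (Suc k)
  then show ?case unfolding Ck_on.simps(2) by (meson subset_eq)
qed

lemma Ck_on_const: "Ck_on k S (\<lambda>x. a)"
  by (induction k arbitrary: a) auto

lemma Ck_on_add:
  assumes "open S"
  shows "Ck_on k S f \<Longrightarrow> Ck_on k S g \<Longrightarrow> Ck_on k S (\<lambda>x. f x + g x)"
proof (induction k arbitrary: f g)
  case 0
  then show ?case by (simp add: continuous_on_add)
next
  case (Suc k)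
  show ?case
  proof (rule Ck_on_SucI[OF assms])
    fix x assume "x \<in> S"
    with Suc.prems have "(f has_derivative frechet_derivative f (at x)) (at x)"
        "(g has_derivative frechet_derivative g (at x)) (at x)"
      by (simp_all add: frechet_derivative_works[symmetric])
    then show "((\<lambda>x. f x + g x) has_derivative
        (\<lambda>v. frechet_derivative f (at x) v + frechet_derivative g (at x) v)) (at x)"
      by (rule has_derivative_add)
  next
    fix v
    show "Ck_on k S (\<lambda>x. frechet_derivative f (at x) v + frechet_derivative g (at x) v)"
      using Suc.prems by (intro Suc.IH) simp_all
  qed
qed

lemma Ck_on_mult:
  fixes f g :: "'a::euclidean_space \<Rightarrow> real"
  assumes "open S"
  shows "Ck_on k S f \<Longrightarrow> Ck_on k S g \<Longrightarrow> Ck_on k S (\<lambda>x. f x * g x)"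
proof (induction k arbitrary: f g)
  case 0
  then show ?case by (simp add: continuous_on_mult)
next
  case (Suc k)
  show ?case
  proof (rule Ck_on_SucI[OF assms])
    fix x assume "x \<in> S"
    with Suc.prems have "(f has_derivative frechet_derivative f (at x)) (at x)"
        "(g has_derivative frechet_derivative g (at x)) (at x)"
      by (simp_all add: frechet_derivative_works[symmetric])
    then show "((\<lambda>x. f x * g x) has_derivative
        (\<lambda>v. f x * frechet_derivative g (at x) v + frechet_derivative f (at x) v * g x)) (at x)"
      by (rule has_derivative_mult)
  next
    fix v
    show "Ck_on k S (\<lambda>x. f x * frechet_derivative g (at x) v + frechet_derivative f (at x) v * g x)"
      using Suc.prems Ck_on_SucD[OF Suc.prems(1)] Ck_on_SucD[OF Suc.prems(2)]
      by (intro Ck_on_add[OF assms] Suc.IH) simp_all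
  qed
qed

lemma Ck_on_inverse:
  fixes f :: "'a::euclidean_space \<Rightarrow> real"
  assumes "open S" and nz: "\<And>x. x \<in> S \<Longrightarrow> f x \<noteq> 0"
  shows "Ck_on k S f \<Longrightarrow> Ck_on k S (\<lambda>x. inverse (f x))"
proof (induction k)
  case 0
  then show ?case using nz by (auto intro: continuous_on_inverse)
next
  case (Suc k)
  show ?case
  proof (rule Ck_on_SucI[OF assms(1)])
    fix x assume "x \<in> S"
    with Suc.prems nz show "((\<lambda>x. inverse (f x)) has_derivative
        (\<lambda>v. (- 1) * (inverse (f x) * frechet_derivative f (at x) v * inverse (f x)))) (at x)"
      using Deriv.has_derivative_inverse[of f x "frechet_derivative f (at x)" UNIV]
      by (simp add: frechet_derivative_works)
  next
    fix v
    show "Ck_on k S (\<lambda>x. (- 1) * (inverse (f x) * frechet_derivative f (at x) v * inverse (f x)))"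
      using Suc.IH[OF Ck_on_SucD[OF Suc.prems]] Suc.prems
      by (intro Ck_on_mult[OF assms(1)] Ck_on_const) simp_all
  qed
qed

lemma Ck_on_sum:
  assumes "open S" "finite I" "\<And>i. i \<in> I \<Longrightarrow> Ck_on k S (f i)"
  shows "Ck_on k S (\<lambda>x. \<Sum>i\<in>I. f i x)"
  using assms(2,3)
proof (induction I)
  case empty
  then show ?case by (simp add: Ck_on_const)
next
  case (insert i I)
  have "Ck_on k S (\<lambda>x. f i x + (\<Sum>i\<in>I. f i x))"
    by (rule Ck_on_add[OF assms(1)]) (simp_all add: insert)
  with insert.hyps show ?case by simp
qed

lemma Ck_on_bounded_linear:
  assumes "open S" "bounded_linear L"
  shows "Ck_on k S f \<Longrightarrow> Ck_on k S (\<lambda>x. L (f x))"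
proof (induction k arbitrary: f)
  case 0
  then show ?case using assms(2) by (simp add: bounded_linear.continuous_on)
next
  case (Suc k)
  show ?case
  proof (rule Ck_on_SucI[OF assms(1)])
    fix x assume "x \<in> S"
    with Suc.prems have "(f has_derivative frechet_derivative f (at x)) (at x)"
      by (simp add: frechet_derivative_works[symmetric])
    then show "((\<lambda>x. L (f x)) has_derivative
        (\<lambda>v. L (frechet_derivative f (at x) v))) (at x)"
      by (rule bounded_linear.has_derivative[OF assms(2)])
  next
    fix v
    show "Ck_on k S (\<lambda>x. L (frechet_derivative f (at x) v))"
      using Suc.prems by (intro Suc.IH) simp
  qed
qed

lemma linear_vec_expansion:
  fixes L :: "real ^ 'n::finite \<Rightarrow> real"
  assumes "linear L"
  shows "L a = (\<Sum>i\<in>UNIV. L (axis i 1) * a $ i)"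
proof -
  have "L a = L (\<Sum>i\<in>UNIV. (a $ i) *\<^sub>R axis i 1)"
    using basis_expansion[of a] by (simp add: scalar_mult_eq_scaleR)
  also have "\<dots> = (\<Sum>i\<in>UNIV. L (axis i 1) * a $ i)"
    by (simp add: linear_sum[OF assms] linear_scale[OF assms] mult.commute)
  finally show ?thesis .
qed

text \<open>By the chain rule, the partial derivatives of \<open>f \<circ> h\<close> are sums of products of
  partial derivatives of \<open>f\<close>, composed with \<open>h\<close>, and partial derivatives of \<open>h\<close>.
  This reduces one order of differentiability of a composition to the product rule.\<close>

lemma Ck_on_compose:
  fixes f :: "real ^ 'n::finite \<Rightarrow> real" and h :: "'a::euclidean_space \<Rightarrow> real ^ 'n"
  assumes "open S" "open T" "h ` S \<subseteq> T"
  shows "Ck_on k T f \<Longrightarrow> Ck_on k S h \<Longrightarrow> Ck_on k S (\<lambda>x. f (h x))"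
proof (induction k arbitrary: f)
  case 0
  then show ?case using assms(3) continuous_on_compose2 by auto
next
  case (Suc k)
  show ?case
  proof (rule Ck_on_SucI[OF assms(1)])
    fix x assume x: "x \<in> S"
    have f: "(f has_derivative frechet_derivative f (at (h x))) (at (h x))"
      using Suc.prems(1) x assms(3) by (auto simp: frechet_derivative_works[symmetric])
    have h: "(h has_derivative frechet_derivative h (at x)) (at x)"
      using Suc.prems(2) x by (auto simp: frechet_derivative_works[symmetric])
    have "((\<lambda>x. f (h x)) has_derivative
        (\<lambda>v. frechet_derivative f (at (h x)) (frechet_derivative h (at x) v))) (at x)"
      using diff_chain_at[OF h f] by (simp add: o_def)
    moreover have "linear (frechet_derivative f (at (h x)))"
      using f has_derivative_linear by blast
    ultimately show "((\<lambda>x. f (h x)) has_derivative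
        (\<lambda>v. \<Sum>i\<in>UNIV. frechet_derivative f (at (h x)) (axis i 1)
           * frechet_derivative h (at x) v $ i)) (at x)"
      by (simp add: linear_vec_expansion[symmetric])
  next
    fix v
    show "Ck_on k S (\<lambda>x. \<Sum>i\<in>UNIV. frechet_derivative f (at (h x)) (axis i 1)
        * frechet_derivative h (at x) v $ i)"
      using Suc.prems Ck_on_SucD[OF Suc.prems(2)]
      by (intro Ck_on_sum Ck_on_mult Suc.IH assms(1)
          Ck_on_bounded_linear[OF assms(1) bounded_linear_vec_nth]) simp_all
  qed
qed

lemma Cinf_on_deriv:
  assumes "Cinf_on S f"
  shows "Cinf_on S (\<lambda>x. frechet_derivative f (at x) v)"
  unfolding Cinf_on_def
proof
  fix k
  have "Ck_on (Suc k) S f" using assms unfolding Cinf_on_def by blast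
  then show "Ck_on k S (\<lambda>x. frechet_derivative f (at x) v)" by simp
qed

lemma Cinf_on_differentiable:
  assumes "Cinf_on S f" "x \<in> S"
  shows "f differentiable (at x)"
proof -
  have "Ck_on (Suc 0) S f" using assms(1) unfolding Cinf_on_def by blast
  with assms(2) show ?thesis by simp
qed


section \<open>Calculus in a chart\<close>

lemma Cinf_on_cong:
  assumes "open S" "\<And>x. x \<in> S \<Longrightarrow> f x = g x"
  shows "Cinf_on S f \<longleftrightarrow> Cinf_on S g"
  unfolding Cinf_on_def using Ck_on_cong[OF assms] by simp

lemma Cinf_on_subset: "Cinf_on S f \<Longrightarrow> T \<subseteq> S \<Longrightarrow> Cinf_on T f"
  unfolding Cinf_on_def using Ck_on_subset by blast

lemma Cinf_on_compose:
  fixes f :: "real ^ 'n::finite \<Rightarrow> real" and h :: "'a::euclidean_space \<Rightarrow> real ^ 'n"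
  assumes "open S" "open T" "h ` S \<subseteq> T" "Cinf_on T f" "Cinf_on S h"
  shows "Cinf_on S (\<lambda>x. f (h x))"
  using Ck_on_compose[OF assms(1,2,3)] assms(4,5) unfolding Cinf_on_def by simp

lemma open_chart_image:
  assumes "is_chart d" "open W"
  shows "open (snd d ` (dom_chart d \<inter> W))"
proof -
  have h: "homeomorphism (dom_chart d) (snd d ` dom_chart d) (snd d) (inv_chart d)"
    and o: "open (snd d ` dom_chart d)"
    using assms(1) by (auto simp: is_chart_def)
  have "snd d ` (dom_chart d \<inter> W) = snd d ` dom_chart d \<inter> inv_chart d -` W"
    using h by (force simp: homeomorphism_def)
  moreover have "open \<dots>"
    using h o assms(2) by (intro continuous_open_preimage) (auto simp: homeomorphism_def)
  ultimately show ?thesis by simp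
qed

lemma inv_chart_chart: "is_chart d \<Longrightarrow> q \<in> dom_chart d \<Longrightarrow> inv_chart d (snd d q) = q"
  by (auto simp: is_chart_def homeomorphism_def)

lemma smooth_fun_on_subset: "smooth_fun_on A W f \<Longrightarrow> V \<subseteq> W \<Longrightarrow> smooth_fun_on A V f"
  unfolding smooth_fun_on_def by (blast intro: Cinf_on_subset)

lemma chart_overlap: "compatible c d \<Longrightarrow>
    Cinf_on (snd d ` (dom_chart c \<inter> dom_chart d)) (\<lambda>x. snd c (inv_chart d x))"
  by (simp add: compatible_def o_def)

locale coordinate_chart =
  fixes A :: "('m::{t2_space, second_countable_topology}, 'n::finite) chart set"
    and c :: "('m, 'n) chart"
  assumes smooth_structure: "smooth_structure A" and c_in_A: "c \<in> A"
begin

abbreviation U :: "'m set" where "U \<equiv> dom_chart c"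
abbreviation partial :: "'n \<Rightarrow> 'm \<Rightarrow> ('m \<Rightarrow> real) \<Rightarrow> real" (\<open>\<partial>\<close>) where
  "\<partial> k \<equiv> coord_field A c k"
abbreviation smooth :: "('m \<Rightarrow> real) \<Rightarrow> bool" where "smooth \<equiv> smooth_fun_on A U"

lemma is_chart_A: "d \<in> A \<Longrightarrow> is_chart d"
  and compatible_A: "d \<in> A \<Longrightarrow> e \<in> A \<Longrightarrow> compatible d e"
  using smooth_structure by (auto simp: smooth_structure_def)

lemma open_U: "open U"
  using is_chart_A[OF c_in_A] by (simp add: is_chart_def)

lemma open_image: "d \<in> A \<Longrightarrow> open W \<Longrightarrow> open (snd d ` (dom_chart d \<inter> W))"
  by (simp add: open_chart_image is_chart_A)

lemma inv_chart: "d \<in> A \<Longrightarrow> q \<in> dom_chart d \<Longrightarrow> inv_chart d (snd d q) = q"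
  by (simp add: inv_chart_chart is_chart_A)

subsection \<open>The algebra of smooth functions\<close>

lemma smooth_fun_on_cong:
  assumes "open W" "\<And>q. q \<in> W \<Longrightarrow> f q = h q"
  shows "smooth_fun_on A W f \<longleftrightarrow> smooth_fun_on A W h"
proof -
  have "Cinf_on (snd d ` (dom_chart d \<inter> W)) (f \<circ> inv_chart d)
      \<longleftrightarrow> Cinf_on (snd d ` (dom_chart d \<inter> W)) (h \<circ> inv_chart d)" if "d \<in> A" for d
    using assms(2) inv_chart[OF that] by (intro Cinf_on_cong open_image[OF that assms(1)]) auto
  then show ?thesis by (simp add: smooth_fun_on_def)
qed

lemma smooth_fun_on_const: "smooth_fun_on A W (\<lambda>q. a)"
  by (simp add: smooth_fun_on_def Cinf_on_def o_def Ck_on_const)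

lemma smooth_fun_on_add:
  "open W \<Longrightarrow> smooth_fun_on A W f \<Longrightarrow> smooth_fun_on A W h \<Longrightarrow> smooth_fun_on A W (\<lambda>q. f q + h q)"
  by (simp add: smooth_fun_on_def Cinf_on_def o_def Ck_on_add open_image)

lemma smooth_fun_on_mult:
  "open W \<Longrightarrow> smooth_fun_on A W f \<Longrightarrow> smooth_fun_on A W h \<Longrightarrow> smooth_fun_on A W (\<lambda>q. f q * h q)"
  by (simp add: smooth_fun_on_def Cinf_on_def o_def Ck_on_mult open_image)

lemma smooth_fun_on_sum:
  "open W \<Longrightarrow> finite I \<Longrightarrow> (\<And>i. i \<in> I \<Longrightarrow> smooth_fun_on A W (f i)) \<Longrightarrow>
    smooth_fun_on A W (\<lambda>q. \<Sum>i\<in>I. f i q)"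
  by (simp add: smooth_fun_on_def Cinf_on_def o_def Ck_on_sum open_image)

lemma smooth_fun_on_inverse:
  assumes "open W" "smooth_fun_on A W f" "\<And>q. q \<in> W \<Longrightarrow> f q \<noteq> 0"
  shows "smooth_fun_on A W (\<lambda>q. inverse (f q))"
  unfolding smooth_fun_on_def Cinf_on_def o_def
proof (intro ballI allI Ck_on_inverse)
  fix d k assume d: "d \<in> A"
  show "open (snd d ` (dom_chart d \<inter> W))" using d assms(1) by (rule open_image)
  show "Ck_on k (snd d ` (dom_chart d \<inter> W)) (\<lambda>x. f (inv_chart d x))"
    using d assms(2) by (simp add: smooth_fun_on_def Cinf_on_def o_def)
  show "f (inv_chart d x) \<noteq> 0" if "x \<in> snd d ` (dom_chart d \<inter> W)" for x
    using that d assms(3) inv_chart by auto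
qed

lemmas smooth_const = smooth_fun_on_const[of U]
lemmas smooth_add = smooth_fun_on_add[OF open_U]
lemmas smooth_mult = smooth_fun_on_mult[OF open_U]
lemmas smooth_sum = smooth_fun_on_sum[OF open_U finite]
lemmas smooth_inverse = smooth_fun_on_inverse[OF open_U]

lemma smooth_minus: "smooth f \<Longrightarrow> smooth (\<lambda>q. - f q)"
  using smooth_mult[OF smooth_const[of "-1"]] by simp

lemma smooth_diff: "smooth f \<Longrightarrow> smooth h \<Longrightarrow> smooth (\<lambda>q. f q - h q)"
  using smooth_add[OF _ smooth_minus, of f h] by simp

lemma smooth_prod:
  assumes "finite I" "\<And>i. i \<in> I \<Longrightarrow> smooth (f i)"
  shows "smooth (\<lambda>q. \<Prod>i\<in>I. f i q)"
  using assms
proof (induction I)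
  case empty
  then show ?case by (simp add: smooth_const)
next
  case (insert i I)
  then have "smooth (\<lambda>q. f i q * (\<Prod>i\<in>I. f i q))" by (intro smooth_mult) auto
  with insert.hyps show ?case by simp
qed

text \<open>Smoothness is a condition in every chart of the atlas. Inside the domain of \<open>c\<close> it is
  enough to check it in \<open>c\<close>, because the other charts differ by a smooth change of coordinates.\<close>

lemma smooth_fun_on_iff:
  assumes W: "open W" "W \<subseteq> U"
  shows "smooth_fun_on A W f \<longleftrightarrow> Cinf_on (snd c ` W) (\<lambda>x. f (inv_chart c x))"
proof
  assume "smooth_fun_on A W f"
  then show "Cinf_on (snd c ` W) (\<lambda>x. f (inv_chart c x))"
    using c_in_A W(2) by (auto simp: smooth_fun_on_def o_def Int_absorb1)
next
  assume f: "Cinf_on (snd c ` W) (\<lambda>x. f (inv_chart c x))"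
  show "smooth_fun_on A W f"
    unfolding smooth_fun_on_def
  proof
    fix d assume d: "d \<in> A"
    let ?S = "snd d ` (dom_chart d \<inter> W)" and ?h = "\<lambda>x. snd c (inv_chart d x)"
    have inv: "inv_chart d x \<in> W" if "x \<in> ?S" for x
      using that inv_chart[OF d] by auto
    have "Cinf_on ?S ?h"
      by (rule Cinf_on_subset[OF chart_overlap[OF compatible_A[OF c_in_A d]]]) (use W(2) in blast)
    then have "Cinf_on ?S (\<lambda>x. f (inv_chart c (?h x)))"
      using open_image[OF d W(1)] open_image[OF c_in_A W(1)] f inv W(2)
      by (intro Cinf_on_compose[of _ "snd c ` W" ?h]) (auto simp: Int_absorb1)
    moreover have "Cinf_on ?S (\<lambda>x. f (inv_chart c (?h x))) \<longleftrightarrow> Cinf_on ?S (f \<circ> inv_chart d)"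
    proof (rule Cinf_on_cong[OF open_image[OF d W(1)]])
      fix x assume "x \<in> ?S"
      then have "inv_chart d x \<in> U" using inv W(2) by blast
      then show "f (inv_chart c (?h x)) = (f \<circ> inv_chart d) x"
        using inv_chart[OF c_in_A] by simp
    qed
    ultimately show "Cinf_on ?S (f \<circ> inv_chart d)" by simp
  qed
qed

lemma smooth_coordinate: "smooth (\<lambda>q. snd c q $ j)"
proof -
  have "Cinf_on (snd d ` (dom_chart d \<inter> U)) (\<lambda>x. snd c (inv_chart d x) $ j)" if "d \<in> A" for d
    using chart_overlap[OF compatible_A[OF c_in_A that]] open_image[OF that open_U]
    unfolding Cinf_on_def
    by (auto simp: Int_commute intro: Ck_on_bounded_linear bounded_linear_vec_nth)
  then show ?thesis by (simp add: smooth_fun_on_def o_def)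
qed

lemma smooth_near_U: "smooth f \<Longrightarrow> p \<in> U \<Longrightarrow> smooth_near A p f"
  using open_U by (auto simp: smooth_near_def)

subsection \<open>Partial derivatives and tangent vectors\<close>

lemma differentiable_in_chart:
  assumes "smooth_near A p f" "d \<in> A" "p \<in> dom_chart d"
  shows "(\<lambda>x. f (inv_chart d x)) differentiable (at (snd d p))"
proof -
  obtain W where W: "open W" "p \<in> W" "smooth_fun_on A W f"
    using assms(1) by (auto simp: smooth_near_def)
  then have "Cinf_on (snd d ` (dom_chart d \<inter> W)) (\<lambda>x. f (inv_chart d x))"
    using assms(2) by (auto simp: smooth_fun_on_def o_def)
  then show ?thesis using assms(3) W(2) by (auto intro: Cinf_on_differentiable)
qed

lemma differentiable_smooth:
  "smooth f \<Longrightarrow> p \<in> U \<Longrightarrow> (\<lambda>x. f (inv_chart c x)) differentiable (at (snd c p))"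
  using differentiable_in_chart smooth_near_U c_in_A by blast

lemma partial_eq:
  "smooth f \<Longrightarrow> p \<in> U \<Longrightarrow>
    \<partial> k p f = frechet_derivative (\<lambda>x. f (inv_chart c x)) (at (snd c p)) (axis k 1)"
  by (simp add: coord_field_def dir_deriv_def smooth_near_U o_def)

lemma partial_const: "p \<in> U \<Longrightarrow> \<partial> k p (\<lambda>q. a) = 0"
  by (simp add: partial_eq smooth_const)

lemma has_derivative_smooth:
  "smooth f \<Longrightarrow> p \<in> U \<Longrightarrow> ((\<lambda>x. f (inv_chart c x)) has_derivative
    frechet_derivative (\<lambda>x. f (inv_chart c x)) (at (snd c p))) (at (snd c p))"
  using differentiable_smooth frechet_derivative_works by blast

lemma partial_add:
  assumes "smooth f" "smooth h" "p \<in> U"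
  shows "\<partial> k p (\<lambda>q. f q + h q) = \<partial> k p f + \<partial> k p h"
  using frechet_derivative_at[OF has_derivative_add[OF has_derivative_smooth has_derivative_smooth],
      OF assms(1,3) assms(2,3), symmetric] assms
  by (simp add: partial_eq smooth_add)

lemma partial_mult:
  assumes "smooth f" "smooth h" "p \<in> U"
  shows "\<partial> k p (\<lambda>q. f q * h q) = \<partial> k p f * h p + f p * \<partial> k p h"
  using frechet_derivative_at[OF has_derivative_mult[OF has_derivative_smooth has_derivative_smooth],
      OF assms(1,3) assms(2,3), symmetric] assms
  by (simp add: partial_eq smooth_mult inv_chart c_in_A)

lemma partial_cmult:
  "smooth f \<Longrightarrow> p \<in> U \<Longrightarrow> \<partial> k p (\<lambda>q. a * f q) = a * \<partial> k p f"
  by (simp add: partial_mult smooth_const partial_const)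

lemma partial_diff:
  assumes "smooth f" "smooth h" "p \<in> U"
  shows "\<partial> k p (\<lambda>q. f q - h q) = \<partial> k p f - \<partial> k p h"
  using partial_add[OF assms(1) smooth_minus[OF assms(2)] assms(3)] partial_cmult[OF assms(2,3), of k "-1"]
  by simp

lemma partial_sum:
  assumes "finite I" "\<And>i. i \<in> I \<Longrightarrow> smooth (f i)" "p \<in> U"
  shows "\<partial> k p (\<lambda>q. \<Sum>i\<in>I. f i q) = (\<Sum>i\<in>I. \<partial> k p (f i))"
  using assms(1,2)
proof (induction I)
  case empty
  then show ?case by (simp add: partial_const assms(3))
next
  case (insert i I)
  then show ?case
    by (simp add: partial_add smooth_fun_on_sum open_U assms(3))
qed

lemma partial_cong:
  assumes "smooth f" "p \<in> U" "\<And>q. q \<in> U \<Longrightarrow> f q = h q"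
  shows "\<partial> k p f = \<partial> k p h"
proof -
  have "smooth h" using assms smooth_fun_on_cong[OF open_U, of f h] by blast
  moreover have "frechet_derivative (\<lambda>x. f (inv_chart c x)) (at (snd c p))
      = frechet_derivative (\<lambda>x. h (inv_chart c x)) (at (snd c p))"
    using open_image[OF c_in_A open_U] assms inv_chart[OF c_in_A]
    by (intro frechet_derivative_transform_within_open[where X = "snd c ` U"] differentiable_smooth) auto
  ultimately show ?thesis using assms by (simp add: partial_eq)
qed

lemma partial_coordinate:
  assumes "p \<in> U"
  shows "\<partial> k p (\<lambda>q. snd c q $ j) = (if k = j then 1 else 0)"
proof -
  have "frechet_derivative (\<lambda>x. snd c (inv_chart c x) $ j) (at (snd c p)) = (\<lambda>x. x $ j)"
  proof (rule frechet_derivative_at[symmetric])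
    show "((\<lambda>x. snd c (inv_chart c x) $ j) has_derivative (\<lambda>x. x $ j)) (at (snd c p))"
    proof (rule has_derivative_transform_within_open)
      show "((\<lambda>x. x $ j) has_derivative (\<lambda>x. x $ j)) (at (snd c p))"
        by (intro bounded_linear_imp_has_derivative bounded_linear_vec_nth)
      show "open (snd c ` U)" using open_image[OF c_in_A open_U] by simp
      show "snd c p \<in> snd c ` U" using assms by simp
      show "x $ j = snd c (inv_chart c x) $ j" if "x \<in> snd c ` U" for x
        using that inv_chart[OF c_in_A] by auto
    qed
  qed
  then show ?thesis
    using assms by (simp add: partial_eq smooth_coordinate axis_def)
qed

text \<open>A coordinate field has to preserve smoothness over every open part of the chart domain, not
  only over the whole of it, to count as a smooth field.\<close>

lemma partial_smooth_on:
  assumes "open W" "W \<subseteq> U" "smooth_fun_on A W f"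
  shows "smooth_fun_on A W (\<lambda>q. \<partial> k q f)"
proof -
  let ?F = "\<lambda>x. frechet_derivative (\<lambda>x. f (inv_chart c x)) (at x) (axis k 1)"
  have W: "open (snd c ` W)"
    using open_image[OF c_in_A assms(1)] assms(2) by (simp add: Int_absorb1)
  have "Cinf_on (snd c ` W) ?F"
    using assms by (intro Cinf_on_deriv) (simp add: smooth_fun_on_iff)
  moreover have "Cinf_on (snd c ` W) ?F
      \<longleftrightarrow> Cinf_on (snd c ` W) (\<lambda>x. ?F (snd c (inv_chart c x)))"
  proof (rule Cinf_on_cong[OF W])
    fix x assume "x \<in> snd c ` W"
    then have "snd c (inv_chart c x) = x"
      using assms(2) inv_chart[OF c_in_A] by auto
    then show "?F x = ?F (snd c (inv_chart c x))" by simp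
  qed
  ultimately have "smooth_fun_on A W (\<lambda>q. ?F (snd c q))"
    unfolding smooth_fun_on_iff[OF assms(1,2)] by simp
  moreover have "?F (snd c q) = \<partial> k q f" if "q \<in> W" for q
  proof -
    have "smooth_near A q f" unfolding smooth_near_def using assms that by blast
    then show ?thesis by (simp add: coord_field_def dir_deriv_def o_def)
  qed
  ultimately show ?thesis
    using smooth_fun_on_cong[OF assms(1), of "\<lambda>q. ?F (snd c q)" "\<lambda>q. \<partial> k q f"] by blast
qed

lemmas smooth_partial = partial_smooth_on[OF open_U order_refl]

lemma dir_deriv_expansion:
  assumes "p \<in> U"
  shows "dir_deriv A c a p f = (\<Sum>k\<in>UNIV. a $ k * \<partial> k p f)"
proof (cases "smooth_near A p f")
  case True
  then have "linear (frechet_derivative (\<lambda>x. f (inv_chart c x)) (at (snd c p)))"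
    using differentiable_in_chart[OF _ c_in_A assms] linear_frechet_derivative by blast
  from linear_vec_expansion[OF this, of a] True show ?thesis
    by (simp add: coord_field_def dir_deriv_def o_def mult.commute)
qed (simp add: coord_field_def dir_deriv_def)

text \<open>The chain rule: a direction in the chart \<open>d\<close> is transformed by the derivative of the change
  of coordinates.\<close>

lemma dir_deriv_change_chart:
  assumes "d \<in> A" "p \<in> dom_chart d" "p \<in> U"
  shows "\<exists>b. dir_deriv A d a p = dir_deriv A c b p"
proof
  let ?h = "\<lambda>x. snd c (inv_chart d x)" and ?S = "snd d ` (dom_chart c \<inter> dom_chart d)"
  let ?b = "frechet_derivative ?h (at (snd d p)) a"
  have S: "open ?S"
    using open_image[OF assms(1) open_U] by (simp add: Int_commute)
  have pS: "snd d p \<in> ?S" using assms by auto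
  have h: "?h differentiable (at (snd d p))"
    using chart_overlap[OF compatible_A[OF c_in_A assms(1)]] pS by (rule Cinf_on_differentiable)
  have hp: "?h (snd d p) = snd c p" using assms inv_chart by simp
  show "dir_deriv A d a p = dir_deriv A c ?b p"
  proof
    fix f
    show "dir_deriv A d a p f = dir_deriv A c ?b p f"
    proof (cases "smooth_near A p f")
      case True
      let ?f = "\<lambda>x. f (inv_chart c x)"
      have fd: "(\<lambda>x. f (inv_chart d x)) differentiable (at (snd d p))"
        using True assms differentiable_in_chart by blast
      have fc: "?f differentiable (at (?h (snd d p)))"
        unfolding hp using True assms c_in_A differentiable_in_chart by blast
      have "frechet_derivative (\<lambda>x. f (inv_chart d x)) (at (snd d p))
          = frechet_derivative (?f \<circ> ?h) (at (snd d p))"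
        using inv_chart assms(1) c_in_A
        by (intro frechet_derivative_transform_within_open[OF fd S pS]) auto
      also have "\<dots> = frechet_derivative ?f (at (snd c p)) \<circ> frechet_derivative ?h (at (snd d p))"
        using frechet_derivative_compose[OF h fc] unfolding hp .
      finally show ?thesis
        using True by (simp add: dir_deriv_def o_def)
    qed (simp add: dir_deriv_def)
  qed
qed

lemma component_sum_partial:
  assumes "p \<in> U"
  shows "component c j (\<lambda>f. \<Sum>k\<in>UNIV. a k * \<partial> k p f) = a j"
  using assms by (simp add: component_def partial_coordinate if_distrib cong: if_cong)

lemma component_partial: "p \<in> U \<Longrightarrow> component c j (\<partial> k p) = (if k = j then 1 else 0)"
  by (simp add: component_def partial_coordinate)

lemma dir_deriv_in_tangent_space: "p \<in> U \<Longrightarrow> dir_deriv A c a p \<in> tangent_space A p"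
  unfolding tangent_space_def using c_in_A by blast

lemma tangent_spaceI:
  assumes "p \<in> U"
  shows "(\<lambda>f. \<Sum>k\<in>UNIV. a k * \<partial> k p f) \<in> tangent_space A p"
proof -
  have "(\<lambda>f. \<Sum>k\<in>UNIV. a k * \<partial> k p f) = dir_deriv A c (\<chi> k. a k) p"
    using dir_deriv_expansion[OF assms] by auto
  then show ?thesis using dir_deriv_in_tangent_space[OF assms] by simp
qed

text \<open>The coordinate fields span the tangent spaces, also those tangent vectors that are
  presented in another chart.\<close>

lemma tangent_expansion:
  assumes "p \<in> U" "v \<in> tangent_space A p"
  shows "v f = (\<Sum>k\<in>UNIV. component c k v * \<partial> k p f)"
proof -
  obtain d a where "d \<in> A" "p \<in> dom_chart d" "v = dir_deriv A d a p"
    using assms(2) by (auto simp: tangent_space_def)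
  then obtain b where "v = dir_deriv A c b p"
    using dir_deriv_change_chart assms(1) by blast
  then have v: "v = (\<lambda>f. \<Sum>k\<in>UNIV. b $ k * \<partial> k p f)"
    using dir_deriv_expansion[OF assms(1)] by auto
  show ?thesis
    unfolding v component_sum_partial[OF assms(1)] ..
qed

lemma partial_in_tangent_space: "p \<in> U \<Longrightarrow> \<partial> k p \<in> tangent_space A p"
  unfolding coord_field_def by (rule dir_deriv_in_tangent_space)

lemma smooth_field_partial: "smooth_field_on A U (\<partial> k)"
  by (simp add: smooth_field_on_def partial_in_tangent_space partial_smooth_on)

lemma smooth_field_sum:
  assumes "\<And>i. smooth (h i)"
  shows "smooth_field_on A U (\<lambda>p f. \<Sum>i\<in>UNIV. h i p * \<partial> i p f)"
  unfolding smooth_field_on_def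
proof (intro conjI ballI allI impI)
  fix p assume "p \<in> U"
  then show "(\<lambda>f. \<Sum>i\<in>UNIV. h i p * \<partial> i p f) \<in> tangent_space A p" by (rule tangent_spaceI)
next
  fix V f assume V: "open V \<and> V \<subseteq> U \<and> smooth_fun_on A V f"
  then show "smooth_fun_on A V (\<lambda>p. \<Sum>i\<in>UNIV. h i p * \<partial> i p f)"
    using smooth_fun_on_subset[OF assms]
    by (intro smooth_fun_on_sum smooth_fun_on_mult partial_smooth_on) simp_all
qed

lemma smooth_component: "smooth_field_on A U Y \<Longrightarrow> smooth (\<lambda>p. component c j (Y p))"
  unfolding smooth_field_on_def component_def using open_U smooth_coordinate by blast

end


section \<open>Torsion-free connections in coordinates\<close>

locale torsion_free_connection = coordinate_chart A c
  for A :: "('m::{t2_space, second_countable_topology}, 'n::finite) chart set"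
    and c :: "('m, 'n) chart" +
  fixes D :: "'m vfield \<Rightarrow> 'm vfield \<Rightarrow> 'm vfield"
  assumes affine_connection: "affine_connection A D" and torsion_free: "torsion_free A D"
begin

abbreviation \<Gamma> :: "'n \<Rightarrow> 'n \<Rightarrow> 'n \<Rightarrow> 'm \<Rightarrow> real" where
  "\<Gamma> \<equiv> christoffel A c D"

lemma connection_axioms:
  assumes "smooth_field_on A U X" "smooth_field_on A U X'" "smooth_field_on A U Y"
    "smooth_field_on A U Y'" "smooth h"
  shows "smooth_field_on A U (D X Y) \<and>
       (\<forall>p\<in>U. D (add_field X X') Y p = add_field (D X Y) (D X' Y) p) \<and>
       (\<forall>p\<in>U. D (scale_field h X) Y p = scale_field h (D X Y) p) \<and>
       (\<forall>p\<in>U. D X (add_field Y Y') p = add_field (D X Y) (D X Y') p) \<and>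
       (\<forall>p\<in>U. D X (scale_field h Y) p =
          add_field (scale_field (\<lambda>q. X q h) Y) (scale_field h (D X Y)) p) \<and>
       ((\<forall>p\<in>U. X p = X' p) \<and> (\<forall>p\<in>U. Y p = Y' p) \<longrightarrow> (\<forall>p\<in>U. D X Y p = D X' Y' p))"
  by (rule affine_connection[unfolded affine_connection_def, THEN spec[of _ U], THEN spec[of _ X],
        THEN spec[of _ X'], THEN spec[of _ Y], THEN spec[of _ Y'], THEN spec[of _ h], THEN mp])
    (simp add: assms open_U)

lemma smooth_field_connection:
  "smooth_field_on A U X \<Longrightarrow> smooth_field_on A U Y \<Longrightarrow> smooth_field_on A U (D X Y)"
  using connection_axioms[OF _ _ _ _ smooth_const] by blast

lemma connection_add:
  "smooth_field_on A U X \<Longrightarrow> smooth_field_on A U Y \<Longrightarrow> smooth_field_on A U Y' \<Longrightarrow> p \<in> U \<Longrightarrow>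
    D X (add_field Y Y') p f = D X Y p f + D X Y' p f"
  using connection_axioms[of X X Y Y' "\<lambda>q. 0"] by (simp add: smooth_const add_field_def)

lemma connection_scale:
  "smooth_field_on A U X \<Longrightarrow> smooth_field_on A U Y \<Longrightarrow> smooth h \<Longrightarrow> p \<in> U \<Longrightarrow>
    D X (scale_field h Y) p f = X p h * Y p f + h p * D X Y p f"
  using connection_axioms[of X X Y Y h] by (simp add: scale_field_def add_field_def)

lemma connection_cong:
  "smooth_field_on A U X \<Longrightarrow> smooth_field_on A U X' \<Longrightarrow> smooth_field_on A U Y \<Longrightarrow>
    smooth_field_on A U Y' \<Longrightarrow> (\<And>q. q \<in> U \<Longrightarrow> X q = X' q) \<Longrightarrow> (\<And>q. q \<in> U \<Longrightarrow> Y q = Y' q) \<Longrightarrow>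
    p \<in> U \<Longrightarrow> D X Y p = D X' Y' p"
  using connection_axioms[OF _ _ _ _ smooth_const] by blast

lemma smooth_field_partial_sum:
  assumes "finite I" "\<And>i. smooth (h i)"
  shows "smooth_field_on A U (\<lambda>p f. \<Sum>i\<in>I. h i p * \<partial> i p f)"
proof -
  \<comment> \<open>Extend the coefficients by 0 to all indices.\<close>
  have "(\<lambda>p f. \<Sum>i\<in>UNIV. (if i \<in> I then h i p else 0) * \<partial> i p f) =
      (\<lambda>p f. \<Sum>i\<in>I. h i p * \<partial> i p f)"
    by (simp add: if_distrib if_distribR sum.If_cases cong: if_cong)
  moreover have "smooth (\<lambda>p. if i \<in> I then h i p else 0)" for i
    using assms(2) by (cases "i \<in> I") (simp_all add: smooth_const)
  ultimately show ?thesis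
    using smooth_field_sum[of "\<lambda>i p. if i \<in> I then h i p else 0"] by simp
qed

lemma connection_zero_left:
  assumes "smooth_field_on A U Y" "p \<in> U"
  shows "D (\<lambda>p f. 0) Y p f = 0"
proof -
  \<comment> \<open>Any coordinate field becomes the zero field when it is multiplied by the function 0.\<close>
  have "\<forall>p\<in>U. D (scale_field (\<lambda>q. 0) (\<partial> undefined)) Y p
      = scale_field (\<lambda>q. 0) (D (\<partial> undefined) Y) p"
    using connection_axioms[OF smooth_field_partial[of undefined] smooth_field_partial[of undefined]
        assms(1) assms(1) smooth_const[of 0]] by blast
  then show ?thesis using assms(2) by (simp add: scale_field_def)
qed

lemma connection_partial_sum:
  assumes "finite I" "\<And>i. smooth (h i)" "p \<in> U"
  shows "D (\<partial> k) (\<lambda>p f. \<Sum>i\<in>I. h i p * \<partial> i p f) p f =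
    (\<Sum>i\<in>I. \<partial> k p (h i) * \<partial> i p f + h i p * D (\<partial> k) (\<partial> i) p f)"
  using assms(1)
proof (induction I)
  case empty
  have "D (\<partial> k) (scale_field (\<lambda>q. 0) (\<partial> k)) p f = 0"
    using assms(3) by (simp add: connection_scale smooth_field_partial smooth_const partial_const)
  then show ?case by (simp add: scale_field_def)
next
  case (insert i I)
  have "(\<lambda>p f. \<Sum>i\<in>insert i I. h i p * \<partial> i p f)
      = add_field (scale_field (h i) (\<partial> i)) (\<lambda>p f. \<Sum>i\<in>I. h i p * \<partial> i p f)"
    using insert.hyps by (simp add: add_field_def scale_field_def)
  moreover have "smooth_field_on A U (scale_field (h i) (\<partial> i))"
    using smooth_field_partial_sum[of "{i}" h] assms(2) by (simp add: scale_field_def)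
  moreover have "smooth_field_on A U (\<lambda>p f. \<Sum>i\<in>I. h i p * \<partial> i p f)"
    using smooth_field_partial_sum insert.hyps assms(2) by blast
  ultimately show ?case
    using insert assms(2,3)
    by (simp add: connection_add connection_scale smooth_field_partial)
qed

text \<open>The usual formula \<open>(\<nabla>\<^sub>k Y)\<^sup>j = \<partial>\<^sub>k Y\<^sup>j + \<Gamma>\<^sup>j\<^sub>k\<^sub>i Y\<^sup>i\<close>. On the chart domain the
  field \<open>Y\<close> may be replaced by its expansion in the coordinate fields, to which additivity and the
  product rule of the connection apply.\<close>

lemma component_connection:
  assumes Y: "smooth_field_on A U Y" and p: "p \<in> U"
  shows "component c j (D (\<partial> k) Y p) =
    \<partial> k p (\<lambda>q. component c j (Y q)) + (\<Sum>i\<in>UNIV. \<Gamma> j k i p * component c i (Y p))"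
proof -
  let ?Z = "\<lambda>p f. \<Sum>i\<in>UNIV. component c i (Y p) * \<partial> i p f"
  have Z: "smooth_field_on A U ?Z"
    by (rule smooth_field_sum) (rule smooth_component[OF Y])
  have "Y q = ?Z q" if "q \<in> U" for q
    using tangent_expansion[OF that] Y that by (auto simp: smooth_field_on_def)
  then have "D (\<partial> k) Y p = D (\<partial> k) ?Z p"
    using connection_cong[OF smooth_field_partial smooth_field_partial Y Z _ _ p] by blast
  then have "component c j (D (\<partial> k) Y p) = (\<Sum>i\<in>UNIV. \<partial> k p (\<lambda>q. component c i (Y q))
      * component c j (\<partial> i p) + component c i (Y p) * component c j (D (\<partial> k) (\<partial> i) p))"
    using connection_partial_sum[OF finite smooth_component[OF Y] p] by (simp add: component_def)
  moreover have "(\<Sum>i\<in>UNIV. a i * component c j (\<partial> i p)) = a j" for a :: "'n \<Rightarrow> real"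
    using p by (simp add: component_partial if_distrib cong: if_cong)
  ultimately show ?thesis
    by (simp add: christoffel_def sum.distrib mult.commute[of "component c _ (Y p)"])
qed

lemma smooth_christoffel: "smooth (\<Gamma> k i j)"
  using smooth_component[OF smooth_field_connection[OF smooth_field_partial smooth_field_partial]]
  by (simp add: christoffel_def[abs_def])

lemma partial_partial_coordinate:
  assumes "p \<in> U"
  shows "\<partial> k p (\<lambda>q. \<partial> l q (\<lambda>q. snd c q $ j)) = 0"
proof -
  have "\<partial> k p (\<lambda>q. \<partial> l q (\<lambda>q. snd c q $ j)) = \<partial> k p (\<lambda>q. if l = j then 1 else 0)"
    using assms smooth_partial[OF smooth_coordinate]
    by (intro partial_cong) (auto simp: partial_coordinate)
  then show ?thesis using assms by (simp add: partial_const)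
qed

text \<open>The existence of a torsion-free connection makes the bracket of two coordinate fields a
  tangent vector at each point. Its components are second derivatives of coordinate functions,
  which vanish. This yields both the symmetry of the Christoffel symbols and the commutation of
  partial derivatives.\<close>

lemma coordinate_bracket:
  assumes p: "p \<in> U"
  shows "lie_bracket A (\<partial> k) (\<partial> l) p f = 0" and "\<Gamma> j k l p = \<Gamma> j l k p"
proof -
  have t: "lie_bracket A (\<partial> k) (\<partial> l) p f = D (\<partial> k) (\<partial> l) p f - D (\<partial> l) (\<partial> k) p f" for f
  proof -
    have "\<forall>p\<in>U. torsion A D (\<partial> k) (\<partial> l) p = (\<lambda>f. 0)"
      by (rule torsion_free[unfolded torsion_free_def, THEN spec[of _ U], THEN spec[of _ "\<partial> k"],
          THEN spec[of _ "\<partial> l"], THEN mp]) (simp add: open_U smooth_field_partial)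
    then have "torsion A D (\<partial> k) (\<partial> l) p f = 0" using p by simp
    then show ?thesis by (simp add: torsion_def)
  qed
  have "lie_bracket A (\<partial> k) (\<partial> l) p (\<lambda>q. snd c q $ j) = 0" for j
    using p by (simp add: lie_bracket_def partial_partial_coordinate)
  then have sym: "\<Gamma> j k l p = \<Gamma> j l k p" for j
    using t by (simp add: christoffel_def component_def)
  have tangent: "D (\<partial> k) (\<partial> l) p \<in> tangent_space A p" for k l
    using smooth_field_connection[OF smooth_field_partial smooth_field_partial] p
    unfolding smooth_field_on_def by blast
  have "D (\<partial> k) (\<partial> l) p f = D (\<partial> l) (\<partial> k) p f"
    unfolding tangent_expansion[OF p tangent, of k l f] tangent_expansion[OF p tangent, of l k f]
    using sym by (simp add: christoffel_def)
  then show "lie_bracket A (\<partial> k) (\<partial> l) p f = 0" using t by simp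
  show "\<Gamma> j k l p = \<Gamma> j l k p" by (rule sym)
qed

lemma partial_commute:
  assumes "smooth f" "p \<in> U"
  shows "\<partial> k p (\<lambda>q. \<partial> l q f) = \<partial> l p (\<lambda>q. \<partial> k q f)"
  using coordinate_bracket(1)[OF assms(2), of k l f] assms by (simp add: lie_bracket_def smooth_near_U)

text \<open>The bracket term of the curvature contributes nothing, since coordinate fields commute.\<close>

lemma curv_comp_christoffel:
  assumes p: "p \<in> U"
  shows "curv_comp A c D i j k l p = \<partial> k p (\<Gamma> j l i) - \<partial> l p (\<Gamma> j k i)
    + (\<Sum>s\<in>UNIV. \<Gamma> j k s p * \<Gamma> s l i p) - (\<Sum>s\<in>UNIV. \<Gamma> j l s p * \<Gamma> s k i p)"
proof -
  have second: "component c j (D (\<partial> k) (D (\<partial> l) (\<partial> i)) p)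
      = \<partial> k p (\<Gamma> j l i) + (\<Sum>s\<in>UNIV. \<Gamma> j k s p * \<Gamma> s l i p)" for k l
    using component_connection[OF smooth_field_connection[OF smooth_field_partial smooth_field_partial] p]
    by (simp add: christoffel_def[abs_def])
  have zero: "smooth_field_on A U (\<lambda>p f. 0)"
    using smooth_field_partial_sum[of "{}" "\<lambda>_ _. 0"] by (simp add: smooth_const)
  have bracket: "smooth_field_on A U (lie_bracket A (\<partial> k) (\<partial> l))"
  proof -
    have eq: "lie_bracket A (\<partial> k) (\<partial> l) q f = 0" if "q \<in> U" for q f
      using coordinate_bracket(1)[OF that] .
    have "smooth_fun_on A V (\<lambda>q. lie_bracket A (\<partial> k) (\<partial> l) q f)" if "open V" "V \<subseteq> U" for V f
      using smooth_fun_on_cong[OF that(1), of "\<lambda>q. lie_bracket A (\<partial> k) (\<partial> l) q f" "\<lambda>q. 0"]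
        eq that(2) smooth_fun_on_const by blast
    moreover have "lie_bracket A (\<partial> k) (\<partial> l) q = (\<lambda>f. 0)" if "q \<in> U" for q
      using eq[OF that] by auto
    ultimately show ?thesis using zero unfolding smooth_field_on_def by simp
  qed
  have "D (lie_bracket A (\<partial> k) (\<partial> l)) (\<partial> i) p = D (\<lambda>p f. 0) (\<partial> i) p"
    using coordinate_bracket(1)
    by (intro connection_cong[OF bracket zero smooth_field_partial smooth_field_partial]) (auto simp: p)
  then have "component c j (D (lie_bracket A (\<partial> k) (\<partial> l)) (\<partial> i) p) = 0"
    using connection_zero_left[OF smooth_field_partial p] by (simp add: component_def)
  then show ?thesis
    using second[of k l] second[of l k]
    by (simp add: curv_comp_def curvature_def component_def)
qed

lemma smooth_curv_comp: "smooth (curv_comp A c D i j k l)"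
proof -
  have "smooth (\<lambda>p. \<partial> k p (\<Gamma> j l i) - \<partial> l p (\<Gamma> j k i)
      + (\<Sum>s\<in>UNIV. \<Gamma> j k s p * \<Gamma> s l i p) - (\<Sum>s\<in>UNIV. \<Gamma> j l s p * \<Gamma> s k i p))"
    by (intro smooth_diff smooth_add smooth_sum smooth_mult smooth_partial smooth_christoffel)
  then show ?thesis
    by (subst smooth_fun_on_cong[OF open_U curv_comp_christoffel])
qed

lemma smooth_ricci: "smooth (ricci A c D i j)"
  unfolding ricci_def[abs_def] by (intro smooth_sum smooth_curv_comp)

end


section \<open>The second Bianchi identity\<close>

lemma matrix_add_rdistrib: "(B + C) ** A = B ** A + (C :: real ^ 'n::finite ^ 'k) ** A"
  by (simp add: vec_eq_iff matrix_matrix_mult_def distrib_right sum.distrib)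

lemma matrix_diff_ldistrib: "A ** (B - C) = A ** B - A ** (C :: real ^ 'k ^ 'n::finite)"
  by (simp add: vec_eq_iff matrix_matrix_mult_def right_diff_distrib sum_subtractf)

lemma matrix_diff_rdistrib: "(B - C) ** A = B ** A - (C :: real ^ 'n::finite ^ 'k) ** A"
  by (simp add: vec_eq_iff matrix_matrix_mult_def left_diff_distrib sum_subtractf)

lemmas matrix_algebra = matrix_add_ldistrib matrix_add_rdistrib matrix_diff_ldistrib
  matrix_diff_rdistrib matrix_mul_assoc

lemma sum_swap_13: "(\<Sum>a\<in>A. \<Sum>b\<in>B. \<Sum>c\<in>C. f a b c) = (\<Sum>c\<in>C. \<Sum>b\<in>B. \<Sum>a\<in>A. f a b c)"
  for f :: "_ \<Rightarrow> _ \<Rightarrow> _ \<Rightarrow> real"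
proof -
  have "(\<Sum>a\<in>A. \<Sum>b\<in>B. \<Sum>c\<in>C. f a b c) = (\<Sum>a\<in>A. \<Sum>c\<in>C. \<Sum>b\<in>B. f a b c)"
    by (rule sum.cong[OF refl]) (rule sum.swap)
  also have "\<dots> = (\<Sum>c\<in>C. \<Sum>a\<in>A. \<Sum>b\<in>B. f a b c)" by (rule sum.swap)
  also have "\<dots> = (\<Sum>c\<in>C. \<Sum>b\<in>B. \<Sum>a\<in>A. f a b c)"
    by (rule sum.cong[OF refl]) (rule sum.swap)
  finally show ?thesis .
qed

lemma sum_rotate: "(\<Sum>a\<in>A. \<Sum>b\<in>B. \<Sum>c\<in>C. f a b c) = (\<Sum>c\<in>C. \<Sum>a\<in>A. \<Sum>b\<in>B. f a b c)"
  for f :: "_ \<Rightarrow> _ \<Rightarrow> _ \<Rightarrow> real"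
  by (rule trans[OF sum_swap_13 sum.cong[OF refl sum.swap]])

text \<open>The covariant derivative along \<open>\<partial>\<^sub>m\<close> of a (1,3)-tensor, with the indices in the order
  of \<open>curv_comp\<close>: the second one is the upper one.\<close>

definition nabla_tensor13 :: "('m::topological_space, 'n::finite) chart set \<Rightarrow> ('m, 'n) chart \<Rightarrow>
    ('m vfield \<Rightarrow> 'm vfield \<Rightarrow> 'm vfield) \<Rightarrow> 'n \<Rightarrow> ('n \<Rightarrow> 'n \<Rightarrow> 'n \<Rightarrow> 'n \<Rightarrow> 'm \<Rightarrow> real) \<Rightarrow>
    'n \<Rightarrow> 'n \<Rightarrow> 'n \<Rightarrow> 'n \<Rightarrow> 'm \<Rightarrow> real" where
  "nabla_tensor13 A c D m T i j k l p = coord_field A c m p (T i j k l)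
     + (\<Sum>s\<in>UNIV. christoffel A c D j m s p * T i s k l p)
     - (\<Sum>s\<in>UNIV. christoffel A c D s m i p * T s j k l p)
     - (\<Sum>s\<in>UNIV. christoffel A c D s m k p * T i j s l p)
     - (\<Sum>s\<in>UNIV. christoffel A c D s m l p * T i j k s p)"

text \<open>The covariant derivative of a (1,1)-tensor whose first index is the upper one.\<close>

definition nabla_tensor11 :: "('m::topological_space, 'n::finite) chart set \<Rightarrow> ('m, 'n) chart \<Rightarrow>
    ('m vfield \<Rightarrow> 'm vfield \<Rightarrow> 'm vfield) \<Rightarrow> 'n \<Rightarrow> ('n \<Rightarrow> 'n \<Rightarrow> 'm \<Rightarrow> real) \<Rightarrow>
    'n \<Rightarrow> 'n \<Rightarrow> 'm \<Rightarrow> real" where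
  "nabla_tensor11 A c D m T i j p = coord_field A c m p (T i j)
     + (\<Sum>s\<in>UNIV. christoffel A c D i m s p * T s j p)
     - (\<Sum>s\<in>UNIV. christoffel A c D s m j p * T i s p)"

context torsion_free_connection
begin

abbreviation R :: "'n \<Rightarrow> 'n \<Rightarrow> 'n \<Rightarrow> 'n \<Rightarrow> 'm \<Rightarrow> real" where
  "R \<equiv> curv_comp A c D"

text \<open>Fixing the form indices makes connection and curvature matrices, whose rows carry the upper
  index. Quadratic expressions in the Christoffel symbols become matrix products.\<close>

definition conn_matrix :: "'n \<Rightarrow> 'm \<Rightarrow> real ^ 'n ^ 'n" where
  "conn_matrix k p = (\<chi> j i. \<Gamma> j k i p)"

definition partial_conn_matrix :: "'n \<Rightarrow> 'n \<Rightarrow> 'm \<Rightarrow> real ^ 'n ^ 'n" where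
  "partial_conn_matrix l k p = (\<chi> j i. \<partial> l p (\<Gamma> j k i))"

definition curv_matrix :: "'n \<Rightarrow> 'n \<Rightarrow> 'm \<Rightarrow> real ^ 'n ^ 'n" where
  "curv_matrix k l p = (\<chi> j i. R i j k l p)"

lemma curv_matrix_eq:
  assumes "p \<in> U"
  shows "curv_matrix k l p = partial_conn_matrix k l p - partial_conn_matrix l k p
    + conn_matrix k p ** conn_matrix l p - conn_matrix l p ** conn_matrix k p"
  by (simp add: vec_eq_iff curv_matrix_def partial_conn_matrix_def conn_matrix_def
      curv_comp_christoffel[OF assms] matrix_matrix_mult_def)

lemma curv_comp_antisym: "p \<in> U \<Longrightarrow> R i j k l p = - R i j l k p"
  by (simp add: curv_comp_christoffel)

lemma partial_curv_comp:
  assumes p: "p \<in> U"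
  shows "\<partial> m p (R i j k l) = \<partial> m p (\<lambda>q. \<partial> k q (\<Gamma> j l i)) - \<partial> m p (\<lambda>q. \<partial> l q (\<Gamma> j k i))
    + (\<Sum>s\<in>UNIV. \<partial> m p (\<Gamma> j k s) * \<Gamma> s l i p + \<Gamma> j k s p * \<partial> m p (\<Gamma> s l i))
    - (\<Sum>s\<in>UNIV. \<partial> m p (\<Gamma> j l s) * \<Gamma> s k i p + \<Gamma> j l s p * \<partial> m p (\<Gamma> s k i))"
proof -
  have "\<partial> m p (R i j k l) = \<partial> m p (\<lambda>q. \<partial> k q (\<Gamma> j l i) - \<partial> l q (\<Gamma> j k i)
      + (\<Sum>s\<in>UNIV. \<Gamma> j k s q * \<Gamma> s l i q) - (\<Sum>s\<in>UNIV. \<Gamma> j l s q * \<Gamma> s k i q))"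
    by (rule partial_cong[OF smooth_curv_comp p]) (rule curv_comp_christoffel)
  then show ?thesis
    using p by (simp add: partial_add partial_diff partial_sum partial_mult smooth_add smooth_diff
        smooth_sum smooth_mult smooth_partial smooth_christoffel)
qed

text \<open>For fixed \<open>k\<close> and \<open>l\<close> the curvature is the matrix
  \<open>F k l = \<partial>\<^sub>k \<Gamma>\<^sub>l - \<partial>\<^sub>l \<Gamma>\<^sub>k + [\<Gamma>\<^sub>k, \<Gamma>\<^sub>l]\<close>, and the cyclic sum of
  \<open>\<partial>\<^sub>m (F k l) + [\<Gamma>\<^sub>m, F k l]\<close> vanishes by the Jacobi identity and because partial
  derivatives commute.\<close>

lemma bianchi_matrix:
  assumes p: "p \<in> U"
  defines "dF \<equiv> \<lambda>m k l. \<chi> j i. \<partial> m p (R i j k l)"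
  defines "B \<equiv> \<lambda>m k l. dF m k l + conn_matrix m p ** curv_matrix k l p
    - curv_matrix k l p ** conn_matrix m p"
  shows "B m k l + B k l m + B l m k = 0"
proof -
  \<comment> \<open>The second derivatives of the connection matrices at \<open>p\<close>.\<close>
  define dd where "dd = (\<lambda>m k l. (\<chi> j i. \<partial> m p (\<lambda>q. \<partial> k q (\<Gamma> j l i))) :: real ^ 'n ^ 'n)"
  let ?G = "\<lambda>k. conn_matrix k p" and ?d = "\<lambda>m k. partial_conn_matrix m k p"
  have dd: "dd m k l = dd k m l" for m k l
    using partial_commute[OF smooth_christoffel p] by (simp add: dd_def vec_eq_iff)
  have dF: "dF m k l = dd m k l - dd m l k + (?d m k ** ?G l + ?G k ** ?d m l)
      - (?d m l ** ?G k + ?G l ** ?d m k)" for m k l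
    by (simp add: dF_def dd_def vec_eq_iff partial_curv_comp[OF p] partial_conn_matrix_def
        conn_matrix_def matrix_matrix_mult_def sum.distrib)
  show ?thesis
    unfolding B_def dF curv_matrix_eq[OF p]
    by (simp add: matrix_algebra dd[of k m l] dd[of l m k] dd[of l k m])
qed

text \<open>The two terms of the covariant derivative that belong to the form indices \<open>k\<close> and \<open>l\<close>
  cancel in the cyclic sum since \<open>\<Gamma>\<close> is symmetric.\<close>

theorem second_bianchi:
  assumes p: "p \<in> U"
  shows "nabla_tensor13 A c D m R i j k l p + nabla_tensor13 A c D k R i j l m p
    + nabla_tensor13 A c D l R i j m k p = 0"
proof -
  have eq: "nabla_tensor13 A c D m R i j k l p =
      ((\<chi> j i. \<partial> m p (R i j k l)) + conn_matrix m p ** curv_matrix k l p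
        - curv_matrix k l p ** conn_matrix m p) $ j $ i
      - (\<Sum>s\<in>UNIV. \<Gamma> s m k p * R i j s l p) + (\<Sum>s\<in>UNIV. \<Gamma> s m l p * R i j s k p)" for m k l
    using curv_comp_antisym[OF p, of i j k]
    by (simp add: nabla_tensor13_def conn_matrix_def curv_matrix_def matrix_matrix_mult_def
        sum_negf mult.commute)
  have "((\<chi> j i. \<partial> m p (R i j k l)) + conn_matrix m p ** curv_matrix k l p
        - curv_matrix k l p ** conn_matrix m p) $ j $ i
      + ((\<chi> j i. \<partial> k p (R i j l m)) + conn_matrix k p ** curv_matrix l m p
        - curv_matrix l m p ** conn_matrix k p) $ j $ i
      + ((\<chi> j i. \<partial> l p (R i j m k)) + conn_matrix l p ** curv_matrix m k p
        - curv_matrix m k p ** conn_matrix l p) $ j $ i = 0"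
    using arg_cong[OF bianchi_matrix[OF p, of m k l], of "\<lambda>M. M $ j $ i"] by simp
  then show ?thesis
    unfolding eq
    using coordinate_bracket(2)[OF p, of _ k m] coordinate_bracket(2)[OF p, of _ l m]
      coordinate_bracket(2)[OF p, of _ l k] by simp
qed

lemma nabla_tensor13_antisym:
  assumes p: "p \<in> U"
  shows "nabla_tensor13 A c D m R i j k l p = - nabla_tensor13 A c D m R i j l k p"
proof -
  have "\<partial> m p (R i j k l) = \<partial> m p (\<lambda>q. - 1 * R i j l k q)"
    by (rule partial_cong[OF smooth_curv_comp p]) (simp add: curv_comp_antisym[of _ i j k l])
  also have "\<dots> = - \<partial> m p (R i j l k)"
    using partial_cmult[OF smooth_curv_comp p, of m "-1"] by simp
  finally have "\<partial> m p (R i j k l) = - \<partial> m p (R i j l k)" .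
  moreover have "R i j k l p = - R i j l k p" for i j by (rule curv_comp_antisym[OF p])
  moreover have "R i j s l p = - R i j l s p" for s by (rule curv_comp_antisym[OF p])
  moreover have "R i j k s p = - R i j s k p" for s by (rule curv_comp_antisym[OF p])
  ultimately show ?thesis
    unfolding nabla_tensor13_def by (simp add: sum_negf)
qed

text \<open>Contraction commutes with covariant differentiation: the Christoffel terms of the upper
  and of the contracted lower index cancel after renaming summation indices.\<close>

lemma nabla_tensor13_contract:
  assumes p: "p \<in> U"
  shows "(\<Sum>k\<in>UNIV. nabla_tensor13 A c D m R i k k l p) = nabla_cov A c D m (ricci A c D) i l p"
proof -
  have "\<partial> m p (ricci A c D i l) = (\<Sum>k\<in>UNIV. \<partial> m p (R i k k l))"
    using p by (simp add: ricci_def[abs_def] partial_sum smooth_curv_comp)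
  moreover have "(\<Sum>k\<in>UNIV. \<Sum>s\<in>UNIV. \<Gamma> k m s p * R i s k l p)
      = (\<Sum>k\<in>UNIV. \<Sum>s\<in>UNIV. \<Gamma> s m k p * R i k s l p)"
    by (rule sum.swap)
  moreover have "(\<Sum>k\<in>UNIV. \<Sum>s\<in>UNIV. \<Gamma> s m i p * R s k k l p)
      = (\<Sum>s\<in>UNIV. \<Gamma> s m i p * ricci A c D s l p)"
    by (subst sum.swap) (simp add: ricci_def sum_distrib_left)
  moreover have "(\<Sum>k\<in>UNIV. \<Sum>s\<in>UNIV. \<Gamma> s m l p * R i k k s p)
      = (\<Sum>s\<in>UNIV. \<Gamma> s m l p * ricci A c D i s p)"
    by (subst sum.swap) (simp add: ricci_def sum_distrib_left)
  ultimately show ?thesis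
    by (simp add: nabla_tensor13_def nabla_cov_def sum.distrib sum_subtractf)
qed

text \<open>Contract the upper index of the Bianchi identity with the first form index. One of the two
  Ricci terms acquires a minus sign from exchanging form indices.\<close>

lemma contracted_bianchi:
  assumes p: "p \<in> U"
  shows "nabla_cov A c D m (ricci A c D) i l p = nabla_cov A c D l (ricci A c D) i m p
    - (\<Sum>k\<in>UNIV. nabla_tensor13 A c D k R i k l m p)"
proof -
  have "(\<Sum>k\<in>UNIV. nabla_tensor13 A c D m R i k k l p + nabla_tensor13 A c D k R i k l m p
      + nabla_tensor13 A c D l R i k m k p) = 0"
    using second_bianchi[OF p] by simp
  moreover have "(\<Sum>k\<in>UNIV. nabla_tensor13 A c D l R i k m k p)
      = - (\<Sum>k\<in>UNIV. nabla_tensor13 A c D l R i k k m p)"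
    by (subst nabla_tensor13_antisym[OF p]) (simp add: sum_negf)
  ultimately show ?thesis
    by (simp add: sum.distrib nabla_tensor13_contract[OF p])
qed

subsection \<open>Product rules\<close>

text \<open>In each of the following rules, the Christoffel terms of a contracted upper index of \<open>K\<close>
  cancel those of the matching lower index of \<open>T\<close>, again after renaming summation indices.\<close>

lemma leibniz_full_contraction:
  assumes K: "\<And>i l. smooth (K i l)" and T: "\<And>i l. smooth (T i l)" and p: "p \<in> U"
  shows "\<partial> m p (\<lambda>q. \<Sum>i\<in>UNIV. \<Sum>l\<in>UNIV. K i l q * T i l q) =
    (\<Sum>i\<in>UNIV. \<Sum>l\<in>UNIV. nabla_con A c D m K i l p * T i l p)
    + (\<Sum>i\<in>UNIV. \<Sum>l\<in>UNIV. K i l p * nabla_cov A c D m T i l p)"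
proof -
  have 1: "(\<Sum>i\<in>UNIV. \<Sum>l\<in>UNIV. \<Sum>s\<in>UNIV. \<Gamma> i m s p * K s l p * T i l p)
      = (\<Sum>i\<in>UNIV. \<Sum>l\<in>UNIV. \<Sum>s\<in>UNIV. K i l p * (\<Gamma> s m i p * T s l p))"
    by (subst sum_swap_13) (simp add: mult_ac)
  have 2: "(\<Sum>i\<in>UNIV. \<Sum>l\<in>UNIV. \<Sum>s\<in>UNIV. \<Gamma> l m s p * K i s p * T i l p)
      = (\<Sum>i\<in>UNIV. \<Sum>l\<in>UNIV. \<Sum>s\<in>UNIV. K i l p * (\<Gamma> s m l p * T i s p))"
    by (rule sum.cong[OF refl], subst sum.swap) (simp add: mult_ac)
  show ?thesis
    using p K T 1 2
    by (simp add: partial_sum partial_mult smooth_sum smooth_mult nabla_con_def nabla_cov_def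
        distrib_right distrib_left right_diff_distrib sum_distrib_left sum_distrib_right
        sum.distrib sum_subtractf)
qed

lemma leibniz_contraction_13:
  assumes K: "\<And>i l. smooth (K i l)" and T: "\<And>i j l m. smooth (T i j l m)" and p: "p \<in> U"
  shows "nabla_tensor11 A c D k (\<lambda>j m q. \<Sum>i\<in>UNIV. \<Sum>l\<in>UNIV. K i l q * T i j l m q) j m p =
    (\<Sum>i\<in>UNIV. \<Sum>l\<in>UNIV. nabla_con A c D k K i l p * T i j l m p)
    + (\<Sum>i\<in>UNIV. \<Sum>l\<in>UNIV. K i l p * nabla_tensor13 A c D k T i j l m p)"
proof -
  have 1: "(\<Sum>i\<in>UNIV. \<Sum>l\<in>UNIV. \<Sum>s\<in>UNIV. \<Gamma> i k s p * K s l p * T i j l m p)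
      = (\<Sum>i\<in>UNIV. \<Sum>l\<in>UNIV. \<Sum>s\<in>UNIV. K i l p * (\<Gamma> s k i p * T s j l m p))"
    by (subst sum_swap_13) (simp add: mult_ac)
  have 2: "(\<Sum>i\<in>UNIV. \<Sum>l\<in>UNIV. \<Sum>s\<in>UNIV. \<Gamma> l k s p * K i s p * T i j l m p)
      = (\<Sum>i\<in>UNIV. \<Sum>l\<in>UNIV. \<Sum>s\<in>UNIV. K i l p * (\<Gamma> s k l p * T i j s m p))"
    by (rule sum.cong[OF refl], subst sum.swap) (simp add: mult_ac)
  have 3: "(\<Sum>i\<in>UNIV. \<Sum>l\<in>UNIV. \<Sum>s\<in>UNIV. K i l p * (\<Gamma> j k s p * T i s l m p))
      = (\<Sum>s\<in>UNIV. \<Sum>i\<in>UNIV. \<Sum>l\<in>UNIV. \<Gamma> j k s p * (K i l p * T i s l m p))"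
    by (subst sum_rotate) (simp add: mult_ac)
  have 4: "(\<Sum>i\<in>UNIV. \<Sum>l\<in>UNIV. \<Sum>s\<in>UNIV. K i l p * (\<Gamma> s k m p * T i j l s p))
      = (\<Sum>s\<in>UNIV. \<Sum>i\<in>UNIV. \<Sum>l\<in>UNIV. \<Gamma> s k m p * (K i l p * T i j l s p))"
    by (subst sum_rotate) (simp add: mult_ac)
  show ?thesis
    using p K T 1 2 3 4
    by (simp add: partial_sum partial_mult smooth_sum smooth_mult nabla_con_def nabla_tensor13_def
        nabla_tensor11_def distrib_right distrib_left right_diff_distrib sum_distrib_left
        sum_distrib_right sum.distrib sum_subtractf)
qed

lemma leibniz_contraction_02:
  assumes K: "\<And>i l. smooth (K i l)" and T: "\<And>i l. smooth (T i l)" and p: "p \<in> U"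
  shows "nabla_tensor11 A c D k (\<lambda>j m q. \<Sum>s\<in>UNIV. K j s q * T s m q) j m p =
    (\<Sum>s\<in>UNIV. nabla_con A c D k K j s p * T s m p)
    + (\<Sum>s\<in>UNIV. K j s p * nabla_cov A c D k T s m p)"
proof -
  have 1: "(\<Sum>s\<in>UNIV. \<Sum>t\<in>UNIV. \<Gamma> s k t p * K j t p * T s m p)
      = (\<Sum>s\<in>UNIV. \<Sum>t\<in>UNIV. K j s p * (\<Gamma> t k s p * T t m p))"
    by (subst sum.swap) (simp add: mult_ac)
  have 2: "(\<Sum>s\<in>UNIV. \<Sum>t\<in>UNIV. \<Gamma> j k t p * K t s p * T s m p)
      = (\<Sum>s\<in>UNIV. \<Sum>t\<in>UNIV. \<Gamma> j k s p * (K s t p * T t m p))"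
    by (subst sum.swap) (simp add: mult_ac)
  have 3: "(\<Sum>s\<in>UNIV. \<Sum>t\<in>UNIV. K j s p * (\<Gamma> t k m p * T s t p))
      = (\<Sum>s\<in>UNIV. \<Sum>t\<in>UNIV. \<Gamma> s k m p * (K j t p * T t s p))"
    by (subst sum.swap) (simp add: mult_ac)
  show ?thesis
    using p K T 1 2 3
    by (simp add: partial_sum partial_mult smooth_sum smooth_mult nabla_con_def nabla_cov_def
        nabla_tensor11_def distrib_right distrib_left right_diff_distrib sum_distrib_left
        sum_distrib_right sum.distrib sum_subtractf)
qed

lemma nabla_tensor11_minus:
  assumes "\<And>i j q. q \<in> U \<Longrightarrow> V i j q = - W i j q" "\<And>i j. smooth (V i j)" "\<And>i j. smooth (W i j)"
    and p: "p \<in> U"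
  shows "nabla_tensor11 A c D k V i j p = - nabla_tensor11 A c D k W i j p"
proof -
  have "\<partial> k p (V i j) = \<partial> k p (\<lambda>q. - 1 * W i j q)"
    by (rule partial_cong[OF assms(2) p]) (simp add: assms(1))
  then have "\<partial> k p (V i j) = - \<partial> k p (W i j)"
    using partial_cmult[OF assms(3) p, of k "-1"] by simp
  then show ?thesis
    by (simp add: nabla_tensor11_def assms(1)[OF p] sum_negf)
qed

lemma nabla_cov_linear:
  assumes "\<And>i j. smooth (S i j)" "\<And>i j. smooth (T i j)" "p \<in> U"
  shows "nabla_cov A c D m (\<lambda>i j q. a * S i j q + b * T i j q) i j p =
    a * nabla_cov A c D m S i j p + b * nabla_cov A c D m T i j p"
  using assms
  by (simp add: nabla_cov_def partial_add partial_cmult smooth_mult smooth_const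
      distrib_left right_diff_distrib sum.distrib sum_distrib_left mult_ac)

lemma nabla_cov_transpose:
  "nabla_cov A c D m (\<lambda>i j. T j i) i j p = nabla_cov A c D m T j i p"
  by (simp add: nabla_cov_def)

lemma nabla_cov_scalar_mult:
  assumes "\<And>i j. smooth (T i j)" "smooth r" "p \<in> U"
  shows "nabla_cov A c D m (\<lambda>i j q. T i j q * r q) i j p =
    nabla_cov A c D m T i j p * r p + T i j p * \<partial> m p r"
  using assms
  by (simp add: nabla_cov_def partial_mult right_diff_distrib sum_distrib_left mult_ac)

end


section \<open>The metric and its inverse in coordinates\<close>

locale chart_metric = coordinate_chart A c
  for A :: "('m::{t2_space, second_countable_topology}, 'n::finite) chart set"
    and c :: "('m, 'n) chart" +
  fixes g :: "'m \<Rightarrow> 'm tvec \<Rightarrow> 'm tvec \<Rightarrow> real"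
  assumes metric: "pseudo_riemannian_metric A g"
begin

abbreviation H :: "'n \<Rightarrow> 'n \<Rightarrow> 'm \<Rightarrow> real" where "H \<equiv> metric_comp A c g"
abbreviation K :: "'n \<Rightarrow> 'n \<Rightarrow> 'm \<Rightarrow> real" where "K \<equiv> inv_metric_comp A c g"

definition metric_matrix :: "'m \<Rightarrow> real ^ 'n ^ 'n" where
  "metric_matrix p = (\<chi> a b. H a b p)"

lemma metric_matrix_nth: "metric_matrix p $ i $ j = H i j p"
  by (simp add: metric_matrix_def)

lemma metric_linear:
  assumes "u \<in> tangent_space A p" "v \<in> tangent_space A p" "w \<in> tangent_space A p"
  shows "g p (\<lambda>f. u f + v f) w = g p u w + g p v w"
    and "g p (\<lambda>f. r * u f) w = r * g p u w" and "g p u w = g p w u"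
  using metric[unfolded pseudo_riemannian_metric_def, THEN conjunct1, rule_format, OF assms]
  by simp_all

lemma metric_nondegenerate:
  assumes "u \<in> tangent_space A p" "\<And>v. v \<in> tangent_space A p \<Longrightarrow> g p u v = 0"
  shows "u = (\<lambda>f. 0)"
  by (rule metric[unfolded pseudo_riemannian_metric_def, THEN conjunct2, THEN conjunct1,
        rule_format, OF assms(1)]) (rule assms(2))

lemma smooth_metric:
  assumes "smooth_field_on A U X" "smooth_field_on A U Y"
  shows "smooth (\<lambda>p. g p (X p) (Y p))"
  by (rule metric[unfolded pseudo_riemannian_metric_def, THEN conjunct2, THEN conjunct2,
        rule_format]) (simp add: assms open_U)

lemma metric_sum_left:
  assumes "finite I" "p \<in> U" "w \<in> tangent_space A p"
  shows "g p (\<lambda>f. \<Sum>i\<in>I. a i * \<partial> i p f) w = (\<Sum>i\<in>I. a i * g p (\<partial> i p) w)"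
  using assms(1)
proof (induction I)
  case empty
  show ?case
    using metric_linear(2)[OF assms(3) assms(3) assms(3), of 0] by simp
next
  case (insert i I)
  have tangent: "(\<lambda>f. \<Sum>i\<in>J. a i * \<partial> i p f) \<in> tangent_space A p" for J
  proof -
    have "(\<lambda>f. \<Sum>i\<in>UNIV. (if i \<in> J then a i else 0) * \<partial> i p f) = (\<lambda>f. \<Sum>i\<in>J. a i * \<partial> i p f)"
      by (simp add: if_distrib if_distribR sum.If_cases cong: if_cong)
    then show ?thesis
      using tangent_spaceI[OF assms(2), of "\<lambda>i. if i \<in> J then a i else 0"] by simp
  qed
  have "g p (\<lambda>f. a i * \<partial> i p f + (\<Sum>i\<in>I. a i * \<partial> i p f)) w
      = g p (\<lambda>f. a i * \<partial> i p f) w + g p (\<lambda>f. \<Sum>i\<in>I. a i * \<partial> i p f) w"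
    using metric_linear(1)[OF tangent[of "{i}"] tangent[of I] assms(3)] by simp
  then show ?case
    using insert metric_linear(2)[OF partial_in_tangent_space[OF assms(2)] assms(3) assms(3)]
    by simp
qed

lemma metric_comp_sym: "p \<in> U \<Longrightarrow> H i j p = H j i p"
  using metric_linear(3)[OF partial_in_tangent_space partial_in_tangent_space partial_in_tangent_space]
  by (simp add: metric_comp_def)

text \<open>A vector in the kernel of the matrix is the coordinate vector of a tangent vector orthogonal
  to all coordinate fields, hence to the whole tangent space.\<close>

lemma invertible_metric_matrix:
  assumes p: "p \<in> U"
  shows "invertible (metric_matrix p)"
proof -
  have "x = 0" if x: "metric_matrix p *v x = 0" for x
  proof -
    let ?u = "\<lambda>f. \<Sum>k\<in>UNIV. x $ k * \<partial> k p f"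
    have u: "?u \<in> tangent_space A p" using p by (rule tangent_spaceI)
    have basis: "g p (\<partial> j p) ?u = 0" for j
    proof -
      have "g p (\<partial> j p) ?u = g p ?u (\<partial> j p)"
        using metric_linear(3)[OF partial_in_tangent_space[OF p] u u] .
      also have "\<dots> = (\<Sum>k\<in>UNIV. x $ k * H k j p)"
        using metric_sum_left[OF finite p partial_in_tangent_space[OF p]] by (simp add: metric_comp_def)
      also have "\<dots> = (metric_matrix p *v x) $ j"
        using metric_comp_sym[OF p, of _ j]
        by (simp add: matrix_vector_mult_def metric_matrix_def mult.commute)
      finally show ?thesis using x by simp
    qed
    have "g p ?u v = 0" if v: "v \<in> tangent_space A p" for v
    proof -
      have "v = (\<lambda>f. \<Sum>k\<in>UNIV. component c k v * \<partial> k p f)"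
        by (rule ext) (rule tangent_expansion[OF p v])
      then have "g p v ?u = g p (\<lambda>f. \<Sum>k\<in>UNIV. component c k v * \<partial> k p f) ?u"
        by (rule arg_cong[where f = "\<lambda>v. g p v ?u"])
      also have "\<dots> = 0" using metric_sum_left[OF finite p u] basis by simp
      finally show ?thesis unfolding metric_linear(3)[OF u v v] .
    qed
    then have zero: "?u = (\<lambda>f. 0)" by (rule metric_nondegenerate[OF u])
    have "x $ k = 0" for k
    proof -
      have "x $ k = component c k ?u" by (rule component_sum_partial[OF p, symmetric])
      also have "\<dots> = 0" unfolding zero by (simp add: component_def)
      finally show ?thesis .
    qed
    then show "x = 0" by (simp add: vec_eq_iff)
  qed
  then obtain B where "B ** metric_matrix p = mat 1"
    using matrix_left_invertible_ker by blast
  then show ?thesis using invertible_left_inverse by blast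
qed

lemma inv_metric_matrix: "matrix_inv (metric_matrix p) $ i $ j = K i j p"
  by (simp add: inv_metric_comp_def metric_matrix_def)

lemma matrix_inv_metric:
  assumes "p \<in> U"
  shows "metric_matrix p ** matrix_inv (metric_matrix p) = mat 1"
    and "matrix_inv (metric_matrix p) ** metric_matrix p = mat 1"
  using someI_ex[OF invertible_metric_matrix[OF assms, unfolded invertible_def]]
  by (auto simp: matrix_inv_def)

lemma transpose_metric_matrix: "p \<in> U \<Longrightarrow> transpose (metric_matrix p) = metric_matrix p"
  by (simp add: transpose_def metric_matrix_def vec_eq_iff metric_comp_sym)

lemma inv_metric_comp_sym:
  assumes p: "p \<in> U"
  shows "K i j p = K j i p"
proof -
  let ?M = "metric_matrix p" and ?N = "matrix_inv (metric_matrix p)"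
  have "transpose ?N ** ?M = transpose (?M ** ?N)"
    using transpose_metric_matrix[OF p] by (simp add: matrix_transpose_mul)
  also have "\<dots> = mat 1" using matrix_inv_metric[OF p] by (simp add: transpose_mat)
  finally have "transpose ?N ** (?M ** ?N) = ?N"
    by (simp add: matrix_mul_assoc)
  then have "transpose ?N = ?N" using matrix_inv_metric[OF p] by simp
  then have "transpose ?N $ i $ j = ?N $ i $ j" by simp
  then show ?thesis by (simp add: transpose_def inv_metric_matrix)
qed

lemma inv_metric_contract:
  assumes "p \<in> U"
  shows "(\<Sum>i\<in>UNIV. K i s p * H i j p) = (if s = j then 1 else 0)"
proof -
  have "(\<Sum>i\<in>UNIV. K i s p * H i j p) = (matrix_inv (metric_matrix p) ** metric_matrix p) $ s $ j"
    using inv_metric_comp_sym[OF assms, of _ s]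
    by (simp add: matrix_matrix_mult_def inv_metric_matrix metric_matrix_nth)
  then show ?thesis using matrix_inv_metric(2)[OF assms] by (simp add: mat_def)
qed

lemma smooth_metric_comp: "smooth (H i j)"
  using smooth_metric[OF smooth_field_partial smooth_field_partial]
  by (simp add: metric_comp_def[abs_def])

lemma smooth_det:
  assumes "\<And>i j. smooth (M i j)"
  shows "smooth (\<lambda>q. det (\<chi> i j. M i j q))"
  unfolding det_def using assms
  by (intro smooth_sum smooth_mult smooth_const smooth_prod) simp_all

text \<open>Cramer's rule writes the inverse metric as a quotient of determinants of smooth
  functions.\<close>

lemma smooth_inv_metric_comp: "smooth (K i j)"
proof -
  let ?num = "\<lambda>q. det (\<chi> a b. if b = i then axis j 1 $ a else H a b q)"
  let ?den = "\<lambda>q. det (\<chi> a b. H a b q)"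
  have den: "?den q \<noteq> 0" if "q \<in> U" for q
    using invertible_metric_matrix[OF that] by (simp add: invertible_det_nz metric_matrix_def)
  have eq: "K i j q = ?num q * inverse (?den q)" if q: "q \<in> U" for q
  proof -
    let ?x = "\<chi> k. matrix_inv (metric_matrix q) $ k $ j"
    have "(metric_matrix q ** matrix_inv (metric_matrix q)) $ a $ j = axis j 1 $ a" for a
      using matrix_inv_metric(1)[OF q] by (simp add: mat_def axis_def)
    then have "metric_matrix q *v ?x = axis j 1"
      by (simp add: vec_eq_iff matrix_vector_mult_def matrix_matrix_mult_def)
    then have "?x = (\<chi> k. det (\<chi> a b. if b = k then axis j 1 $ a else metric_matrix q $ a $ b)
        / det (metric_matrix q))"
      using cramer[of "metric_matrix q"] den[OF q] by (simp add: metric_matrix_def)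
    then have "?x $ i = det (\<chi> a b. if b = i then axis j 1 $ a else metric_matrix q $ a $ b)
        / det (metric_matrix q)"
      by simp
    then show ?thesis
      by (simp add: inv_metric_matrix metric_matrix_nth divide_inverse cong: if_cong)
        (simp add: metric_matrix_def)
  qed
  have "smooth (\<lambda>q. if b = i then axis j 1 $ a else H a b q)" for a b
    by (cases "b = i") (simp_all add: smooth_const smooth_metric_comp)
  then have "smooth (\<lambda>q. ?num q * inverse (?den q))"
    using den by (intro smooth_mult smooth_inverse smooth_det smooth_metric_comp) simp_all
  then show ?thesis by (subst smooth_fun_on_cong[OF open_U eq])
qed

end

lemma transpose_add: "transpose (B + C) = transpose B + transpose (C :: real ^ 'n ^ 'm)"
  and transpose_diff: "transpose (B - C) = transpose B - transpose (C :: real ^ 'n ^ 'm)"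
  by (simp_all add: transpose_def vec_eq_iff)

section \<open>Dual connections\<close>

locale dual_connections = chart_metric A c g + D: torsion_free_connection A c D
    + Ds: torsion_free_connection A c Ds
  for A :: "('m::{t2_space, second_countable_topology}, 'n::finite) chart set"
    and c :: "('m, 'n) chart" and g D Ds +
  assumes duality: "smooth_field_on A (dom_chart c) X \<Longrightarrow> smooth_field_on A (dom_chart c) Y \<Longrightarrow>
    smooth_field_on A (dom_chart c) Z \<Longrightarrow> p \<in> dom_chart c \<Longrightarrow>
    X p (\<lambda>q. g q (Y q) (Z q)) = g p (D X Y p) (Z p) + g p (Y p) (Ds X Z p)"
begin

text \<open>The relation between a connection and its dual is symmetric because \<open>g\<close> is: exchange the
  arguments of all three occurrences of \<open>g\<close>.\<close>

lemma dual_connections_swap: "dual_connections A c g Ds D"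
proof
  fix X Y Z p
  assume XYZ: "smooth_field_on A U X" "smooth_field_on A U Y" "smooth_field_on A U Z"
    and p: "p \<in> U"
  have tangent: "V p \<in> tangent_space A p" if "smooth_field_on A U V" for V
    using that p unfolding smooth_field_on_def by blast
  have eq: "g q (Y q) (Z q) = g q (Z q) (Y q)" if "q \<in> U" for q
    by (rule metric_linear(3)[of _ _ "Z q"]) (use XYZ that in \<open>simp_all add: smooth_field_on_def\<close>)
  have "X p (\<lambda>q. g q (Y q) (Z q)) = (\<Sum>k\<in>UNIV. component c k (X p) * \<partial> k p (\<lambda>q. g q (Y q) (Z q)))"
    by (rule tangent_expansion[OF p tangent[OF XYZ(1)]])
  also have "\<dots> = (\<Sum>k\<in>UNIV. component c k (X p) * \<partial> k p (\<lambda>q. g q (Z q) (Y q)))"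
    using partial_cong[OF smooth_metric[OF XYZ(2,3)] p eq] by simp
  also have "\<dots> = X p (\<lambda>q. g q (Z q) (Y q))"
    by (rule tangent_expansion[OF p tangent[OF XYZ(1)], symmetric])
  also have "\<dots> = g p (D X Z p) (Y p) + g p (Z p) (Ds X Y p)"
    by (rule duality[OF XYZ(1,3,2) p])
  also have "\<dots> = g p (Ds X Y p) (Z p) + g p (Y p) (D X Z p)"
    using metric_linear(3)[OF tangent tangent tangent] XYZ
      D.smooth_field_connection[OF XYZ(1,3)] Ds.smooth_field_connection[OF XYZ(1,2)] by simp
  finally show "X p (\<lambda>q. g q (Y q) (Z q)) = g p (Ds X Y p) (Z p) + g p (Y p) (D X Z p)" .
qed

lemma partial_metric_comp:
  assumes p: "p \<in> U"
  shows "\<partial> k p (H i j) = (\<Sum>s\<in>UNIV. D.\<Gamma> s k i p * H s j p) + (\<Sum>s\<in>UNIV. H i s p * Ds.\<Gamma> s k j p)"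
proof -
  have expand: "V p = (\<lambda>f. \<Sum>s\<in>UNIV. component c s (V p) * \<partial> s p f)"
    if "smooth_field_on A U V" for V
  proof
    have "V p \<in> tangent_space A p" using that p unfolding smooth_field_on_def by blast
    then show "V p f = (\<Sum>s\<in>UNIV. component c s (V p) * \<partial> s p f)" for f
      by (rule tangent_expansion[OF p])
  qed
  note 1 = expand[OF D.smooth_field_connection[OF smooth_field_partial smooth_field_partial],
      of k i, folded christoffel_def]
  note 2 = expand[OF Ds.smooth_field_connection[OF smooth_field_partial smooth_field_partial],
      of k j, folded christoffel_def]
  have "\<partial> k p (H i j) = g p (D (\<partial> k) (\<partial> i) p) (\<partial> j p) + g p (\<partial> i p) (Ds (\<partial> k) (\<partial> j) p)"
    using duality[OF smooth_field_partial smooth_field_partial smooth_field_partial p]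
    by (simp add: metric_comp_def[abs_def])
  also have "g p (D (\<partial> k) (\<partial> i) p) (\<partial> j p) = (\<Sum>s\<in>UNIV. D.\<Gamma> s k i p * H s j p)"
    by (subst 1) (use metric_sum_left[OF finite p partial_in_tangent_space[OF p]]
      in \<open>simp add: metric_comp_def\<close>)
  also have "g p (\<partial> i p) (Ds (\<partial> k) (\<partial> j) p) = g p (Ds (\<partial> k) (\<partial> j) p) (\<partial> i p)"
    by (subst (1 2) 2) (rule metric_linear(3)[OF partial_in_tangent_space[OF p]
        partial_in_tangent_space[OF p] tangent_spaceI[OF p]])
  also have "\<dots> = (\<Sum>s\<in>UNIV. H i s p * Ds.\<Gamma> s k j p)"
    by (subst 2) (use metric_sum_left[OF finite p partial_in_tangent_space[OF p]]
      metric_comp_sym[OF p, of i] in \<open>simp add: metric_comp_def mult.commute[of "g p _ _"]\<close>)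
  finally show ?thesis .
qed

text \<open>The two curvatures are adjoint up to sign, \<open>g (R(X, Y) Z, W) = - g (Z, R\<^sup>*(X, Y) W)\<close>.
  In matrix form, differentiate
  \<open>\<partial>\<^sub>l g = \<Gamma>\<^sub>l\<^sup>T g + g \<Gamma>\<^sub>l\<^sup>*\<close> once more and
  antisymmetrize; the left-hand side drops out because partial derivatives commute.\<close>

lemma curvature_duality_matrix:
  assumes p: "p \<in> U"
  shows "transpose (D.curv_matrix k l p) ** metric_matrix p
    + metric_matrix p ** Ds.curv_matrix k l p = 0"
proof -
  let ?M = "metric_matrix p"
  let ?G = "\<lambda>k. D.conn_matrix k p" and ?Gs = "\<lambda>k. Ds.conn_matrix k p"
  let ?d = "\<lambda>k l. D.partial_conn_matrix k l p" and ?ds = "\<lambda>k l. Ds.partial_conn_matrix k l p"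
  \<comment> \<open>The entrywise first and second derivatives of the metric at \<open>p\<close>.\<close>
  define dM where "dM = (\<lambda>k. (\<chi> i j. \<partial> k p (H i j)) :: real ^ 'n ^ 'n)"
  define ddM where "ddM = (\<lambda>k l. (\<chi> i j. \<partial> k p (\<lambda>q. \<partial> l q (H i j))) :: real ^ 'n ^ 'n)"
  have dM: "dM k = transpose (?G k) ** ?M + ?M ** ?Gs k" for k
    by (simp add: dM_def vec_eq_iff partial_metric_comp[OF p] transpose_def matrix_matrix_mult_def
        D.conn_matrix_def Ds.conn_matrix_def metric_matrix_def)
  have "\<partial> k p (\<lambda>q. \<partial> l q (H i j)) =
      (\<Sum>s\<in>UNIV. \<partial> k p (D.\<Gamma> s l i) * H s j p + D.\<Gamma> s l i p * \<partial> k p (H s j))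
      + (\<Sum>s\<in>UNIV. \<partial> k p (H i s) * Ds.\<Gamma> s l j p + H i s p * \<partial> k p (Ds.\<Gamma> s l j))" for k l i j
  proof -
    have "\<partial> k p (\<lambda>q. \<partial> l q (H i j)) = \<partial> k p (\<lambda>q. (\<Sum>s\<in>UNIV. D.\<Gamma> s l i q * H s j q)
        + (\<Sum>s\<in>UNIV. H i s q * Ds.\<Gamma> s l j q))"
      by (rule partial_cong[OF smooth_partial[OF smooth_metric_comp] p partial_metric_comp])
    then show ?thesis
      using p by (simp add: partial_add partial_sum partial_mult smooth_sum smooth_mult
          smooth_metric_comp D.smooth_christoffel Ds.smooth_christoffel)
  qed
  then have ddM: "ddM k l = transpose (?d k l) ** ?M + transpose (?G l) ** dM k
      + (dM k ** ?Gs l + ?M ** ?ds k l)" for k l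
    by (simp add: ddM_def dM_def vec_eq_iff transpose_def matrix_matrix_mult_def sum.distrib
        D.conn_matrix_def Ds.conn_matrix_def D.partial_conn_matrix_def Ds.partial_conn_matrix_def
        metric_matrix_def)
  have "ddM k l = ddM l k"
    using D.partial_commute[OF smooth_metric_comp p] by (simp add: ddM_def vec_eq_iff)
  then show ?thesis
    unfolding ddM dM D.curv_matrix_eq[OF p] Ds.curv_matrix_eq[OF p]
    by (simp add: matrix_algebra matrix_transpose_mul transpose_add transpose_diff)
      (simp add: algebra_simps)
qed

text \<open>Multiplying the matrix identity by the inverse metric from both sides raises indices;
  its diagonal then sums to a Ricci tensor of the dual connection.\<close>

lemma curvature_trace_duality:
  assumes p: "p \<in> U"
  shows "(\<Sum>i\<in>UNIV. \<Sum>l\<in>UNIV. K i l p * curv_comp A c D i j l m p)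
    = - (\<Sum>s\<in>UNIV. K j s p * ricci A c Ds s m p)"
proof -
  let ?M = "metric_matrix p" and ?N = "matrix_inv (metric_matrix p)"
  have N: "?N ** ?M = mat 1" "?M ** ?N = mat 1" using matrix_inv_metric[OF p] by auto
  have "?N ** transpose (D.curv_matrix l m p) = - (Ds.curv_matrix l m p ** ?N)" for l
  proof -
    have "?N ** (transpose (D.curv_matrix l m p) ** ?M + ?M ** Ds.curv_matrix l m p) ** ?N = 0"
      unfolding curvature_duality_matrix[OF p] by simp
    then have "?N ** transpose (D.curv_matrix l m p) ** (?M ** ?N)
        + (?N ** ?M) ** Ds.curv_matrix l m p ** ?N = 0"
      by (simp only: matrix_algebra)
    then show ?thesis unfolding N by (simp add: eq_neg_iff_add_eq_0)
  qed
  then have "(?N ** transpose (D.curv_matrix l m p)) $ l $ j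
      = - (Ds.curv_matrix l m p ** ?N) $ l $ j" for l
    by simp
  then have eq: "(\<Sum>i\<in>UNIV. K l i p * curv_comp A c D i j l m p)
      = - (\<Sum>s\<in>UNIV. curv_comp A c Ds s l l m p * K s j p)" for l
    by (simp add: matrix_matrix_mult_def inv_metric_matrix transpose_def D.curv_matrix_def
        Ds.curv_matrix_def)
  have "(\<Sum>i\<in>UNIV. \<Sum>l\<in>UNIV. K i l p * curv_comp A c D i j l m p)
      = (\<Sum>l\<in>UNIV. \<Sum>i\<in>UNIV. K l i p * curv_comp A c D i j l m p)"
    by (subst sum.swap) (simp add: inv_metric_comp_sym[OF p])
  also have "\<dots> = - (\<Sum>l\<in>UNIV. \<Sum>s\<in>UNIV. K j s p * curv_comp A c Ds s l l m p)"
    unfolding eq sum_negf using inv_metric_comp_sym[OF p, of _ j] by (simp add: mult.commute)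
  also have "\<dots> = - (\<Sum>s\<in>UNIV. K j s p * ricci A c Ds s m p)"
    by (subst sum.swap) (simp add: ricci_def sum_distrib_left)
  finally show ?thesis .
qed

end


section \<open>The divergence of the Einstein tensor\<close>

context dual_connections
begin

lemma smooth_ricci_scalar: "smooth (ricci_scalar A c g D)"
  unfolding ricci_scalar_def[abs_def]
  by (intro smooth_sum smooth_mult smooth_inv_metric_comp D.smooth_ricci)

lemma smooth_ricci_sym: "smooth (ricci_sym A c D i j)"
  unfolding ricci_sym_def[abs_def]
  by (intro smooth_mult smooth_add smooth_const D.smooth_ricci)

lemma nabla_ricci_sym:
  assumes "p \<in> U"
  shows "nabla_cov A c D m (ricci_sym A c D) i j p =
    1/2 * (nabla_cov A c D m (ricci A c D) i j p + nabla_cov A c D m (ricci A c D) j i p)"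
proof -
  have "ricci_sym A c D = (\<lambda>i j q. 1/2 * ricci A c D i j q + 1/2 * ricci A c D j i q)"
    by (intro ext) (simp add: ricci_sym_def)
  then show ?thesis
    using D.nabla_cov_linear[of "ricci A c D" "\<lambda>i j. ricci A c D j i", OF D.smooth_ricci D.smooth_ricci assms,
        of m "1/2" "1/2" i j]
    by (simp add: D.nabla_cov_transpose[of _ "ricci A c D"])
qed

text \<open>This is the product rule for \<open>g\<^sub>i\<^sub>j R\<close>, where \<open>g\<^sup>i\<^sup>s g\<^sub>i\<^sub>j\<close> contracts to the identity.
  Any torsion-free connection may serve for the divergence; the two cases of interest are \<open>D\<close>
  itself and its dual.\<close>

lemma divergence_einstein:
  assumes B: "torsion_free_connection A c B" and p: "p \<in> U"
  shows "(\<Sum>i\<in>UNIV. nabla_up A c g B i (einstein A c g D) i j p) =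
    (\<Sum>i\<in>UNIV. nabla_up A c g B i (ricci_sym A c D) i j p)
    - 1/2 * (\<Sum>i\<in>UNIV. nabla_up A c g B i H i j p) * ricci_scalar A c g D p
    - 1/2 * \<partial> j p (ricci_scalar A c g D)"
proof -
  let ?r = "ricci_scalar A c g D"
  interpret B: torsion_free_connection A c B by (rule B)
  have einstein: "einstein A c g D = (\<lambda>i j q. 1 * ricci_sym A c D i j q + (- 1/2) * (H i j q * ?r q))"
    by (intro ext) (simp add: einstein_def)
  have "nabla_cov A c B s (\<lambda>i j q. 1 * ricci_sym A c D i j q + (- 1/2) * (H i j q * ?r q)) i j p
      = 1 * nabla_cov A c B s (ricci_sym A c D) i j p
        + (- 1/2) * nabla_cov A c B s (\<lambda>i j q. H i j q * ?r q) i j p" for s i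
    by (rule B.nabla_cov_linear[OF smooth_ricci_sym _ p])
      (rule smooth_mult[OF smooth_metric_comp smooth_ricci_scalar])
  moreover have "nabla_cov A c B s (\<lambda>i j q. H i j q * ?r q) i j p
      = nabla_cov A c B s H i j p * ?r p + H i j p * \<partial> s p ?r" for s i
    by (rule B.nabla_cov_scalar_mult[OF smooth_metric_comp smooth_ricci_scalar p])
  ultimately have "nabla_cov A c B s (einstein A c g D) i j p = nabla_cov A c B s (ricci_sym A c D) i j p
      - 1/2 * (nabla_cov A c B s H i j p * ?r p + H i j p * \<partial> s p ?r)" for s i
    unfolding einstein by simp
  then have summand: "K i s p * nabla_cov A c B s (einstein A c g D) i j p
      = K i s p * nabla_cov A c B s (ricci_sym A c D) i j p
        - 1/2 * (K i s p * nabla_cov A c B s H i j p) * ?r p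
        - 1/2 * (K i s p * H i j p * \<partial> s p ?r)" for i s
    by (simp only:) (simp add: algebra_simps)
  have "(\<Sum>i\<in>UNIV. nabla_up A c g B i (einstein A c g D) i j p) =
      (\<Sum>i\<in>UNIV. nabla_up A c g B i (ricci_sym A c D) i j p)
      - 1/2 * (\<Sum>i\<in>UNIV. nabla_up A c g B i H i j p) * ?r p
      - 1/2 * (\<Sum>i\<in>UNIV. \<Sum>s\<in>UNIV. K i s p * H i j p * \<partial> s p ?r)"
    by (simp only: nabla_up_def summand sum_subtractf sum_distrib_left sum_distrib_right)
  moreover have "(\<Sum>i\<in>UNIV. \<Sum>s\<in>UNIV. K i s p * H i j p * \<partial> s p ?r) = \<partial> j p ?r"
  proof -
    have "(\<Sum>i\<in>UNIV. \<Sum>s\<in>UNIV. K i s p * H i j p * \<partial> s p ?r)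
        = (\<Sum>s\<in>UNIV. (\<Sum>i\<in>UNIV. K i s p * H i j p) * \<partial> s p ?r)"
      by (subst sum.swap) (simp add: sum_distrib_right)
    then show ?thesis by (simp add: inv_metric_contract[OF p] if_distrib if_distribR cong: if_cong)
  qed
  ultimately show ?thesis by simp
qed

text \<open>The heart of the matter: the doubly contracted Bianchi identity. Each of the three product
  rules that move the inverse metric past a covariant derivative contributes one term with a
  derivative of \<open>g\<^sup>l\<^sup>s\<close>, and the curvature term turns into a Ricci term of the dual connection.\<close>

lemma partial_ricci_scalar:
  assumes p: "p \<in> U"
  shows "\<partial> j p (ricci_scalar A c g D) =
    (\<Sum>h\<in>UNIV. \<Sum>l\<in>UNIV. \<Sum>s\<in>UNIV. nabla_con A c D h K l s p * curv_comp A c D l h s j p)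
    + (\<Sum>l\<in>UNIV. \<Sum>s\<in>UNIV. nabla_con A c D j K l s p * ricci A c D l s p)
    + (\<Sum>h\<in>UNIV. \<Sum>s\<in>UNIV. nabla_con A c D h K h s p * ricci A c Ds s j p)
    + (\<Sum>i\<in>UNIV. nabla_up A c g D i (ricci A c D) i j p)
    + (\<Sum>i\<in>UNIV. nabla_up A c g D i (ricci A c Ds) i j p)"
    (is "_ = ?A1 + ?A2 + ?A3 + ?X + ?Y")
proof -
  let ?R = "curv_comp A c D"
  let ?V = "\<lambda>h m q. \<Sum>l\<in>UNIV. \<Sum>s\<in>UNIV. K l s q * ?R l h s m q"
  let ?W = "\<lambda>h m q. \<Sum>s\<in>UNIV. K h s q * ricci A c Ds s m q"
  have ricci_scalar: "\<partial> j p (ricci_scalar A c g D) = ?A2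
      + (\<Sum>i\<in>UNIV. \<Sum>l\<in>UNIV. K i l p * nabla_cov A c D j (ricci A c D) i l p)"
    using D.leibniz_full_contraction[of K "ricci A c D", OF smooth_inv_metric_comp D.smooth_ricci p]
    by (simp add: ricci_scalar_def[abs_def])
  have bianchi: "(\<Sum>i\<in>UNIV. \<Sum>l\<in>UNIV. K i l p * nabla_cov A c D j (ricci A c D) i l p) = ?X
      - (\<Sum>i\<in>UNIV. \<Sum>l\<in>UNIV. K i l p * (\<Sum>h\<in>UNIV. nabla_tensor13 A c D h ?R i h l j p))"
    by (subst D.contracted_bianchi[OF p])
      (simp add: right_diff_distrib sum_subtractf nabla_up_def)
  have reorder: "(\<Sum>i\<in>UNIV. \<Sum>l\<in>UNIV. K i l p * (\<Sum>h\<in>UNIV. nabla_tensor13 A c D h ?R i h l j p))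
      = (\<Sum>h\<in>UNIV. \<Sum>i\<in>UNIV. \<Sum>l\<in>UNIV. K i l p * nabla_tensor13 A c D h ?R i h l j p)"
    by (simp add: sum_distrib_left) (rule sum_rotate)
  have leibniz: "(\<Sum>h\<in>UNIV. \<Sum>i\<in>UNIV. \<Sum>l\<in>UNIV. K i l p * nabla_tensor13 A c D h ?R i h l j p)
      = (\<Sum>h\<in>UNIV. nabla_tensor11 A c D h ?V h j p) - ?A1"
    by (simp add: D.leibniz_contraction_13[of K ?R, OF smooth_inv_metric_comp D.smooth_curv_comp p]
        sum.distrib)
  have duality_V: "(\<Sum>h\<in>UNIV. nabla_tensor11 A c D h ?V h j p)
      = - (\<Sum>h\<in>UNIV. nabla_tensor11 A c D h ?W h j p)"
  proof -
    have "nabla_tensor11 A c D h ?V h j p = - nabla_tensor11 A c D h ?W h j p" for h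
      by (rule D.nabla_tensor11_minus[OF curvature_trace_duality _ _ p])
        (assumption
          | intro smooth_sum smooth_mult smooth_inv_metric_comp D.smooth_curv_comp Ds.smooth_ricci)+
    then show ?thesis by (simp add: sum_negf)
  qed
  have leibniz_dual: "(\<Sum>h\<in>UNIV. nabla_tensor11 A c D h ?W h j p) = ?A3
      + (\<Sum>h\<in>UNIV. \<Sum>s\<in>UNIV. K h s p * nabla_cov A c D h (ricci A c Ds) s j p)"
    by (simp add: D.leibniz_contraction_02[of K "ricci A c Ds", OF smooth_inv_metric_comp Ds.smooth_ricci p]
        sum.distrib)
  have symmetry: "(\<Sum>h\<in>UNIV. \<Sum>s\<in>UNIV. K h s p * nabla_cov A c D h (ricci A c Ds) s j p) = ?Y"
    unfolding nabla_up_def by (subst sum.swap) (simp add: inv_metric_comp_sym[OF p])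
  show ?thesis
    unfolding ricci_scalar bianchi reorder leibniz duality_V leibniz_dual symmetry by simp
qed

theorem divergence_einstein_dual:
  assumes p: "p \<in> U"
  shows "(\<Sum>i\<in>UNIV. nabla_up A c g D i (einstein A c g D) i j p) =
      - 1/2 * (
        (\<Sum>i\<in>UNIV. nabla_up A c g D i (\<lambda>a b q. ricci A c Ds a b q - ricci A c D b a q) i j p)
        + (\<Sum>i\<in>UNIV. nabla_up A c g D i H i j p) * ricci_scalar A c g D p
        + (\<Sum>h\<in>UNIV. \<Sum>l\<in>UNIV. \<Sum>s\<in>UNIV. nabla_con A c D h K l s p * curv_comp A c D l h s j p)
        + (\<Sum>l\<in>UNIV. \<Sum>s\<in>UNIV. nabla_con A c D j K l s p * ricci A c D l s p)
        + (\<Sum>h\<in>UNIV. \<Sum>s\<in>UNIV. nabla_con A c D h K h s p * ricci A c Ds s j p))"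
proof -
  let ?X = "\<Sum>i\<in>UNIV. nabla_up A c g D i (ricci A c D) i j p"
  \<comment> \<open>The divergence of the transposed Ricci tensor occurs on both sides of the equation.\<close>
  let ?X' = "\<Sum>i\<in>UNIV. \<Sum>s\<in>UNIV. K i s p * nabla_cov A c D s (ricci A c D) j i p"
  let ?Y = "\<Sum>i\<in>UNIV. nabla_up A c g D i (ricci A c Ds) i j p"
  have "(\<Sum>i\<in>UNIV. nabla_up A c g D i (ricci_sym A c D) i j p) = 1/2 * (?X + ?X')"
    by (simp add: nabla_up_def nabla_ricci_sym[OF p] distrib_left sum.distrib sum_distrib_left
        sum_divide_distrib add_divide_distrib)
  moreover have "(\<Sum>i\<in>UNIV. nabla_up A c g D i (\<lambda>a b q. ricci A c Ds a b q - ricci A c D b a q) i j p)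
      = ?Y - ?X'"
  proof -
    have "nabla_cov A c D s (\<lambda>a b q. ricci A c Ds a b q - ricci A c D b a q) i j p
        = nabla_cov A c D s (ricci A c Ds) i j p - nabla_cov A c D s (ricci A c D) j i p" for s i
      using D.nabla_cov_linear[of "ricci A c Ds" "\<lambda>i j. ricci A c D j i",
          OF Ds.smooth_ricci D.smooth_ricci p, of s 1 "- 1" i j]
      by (simp add: D.nabla_cov_transpose[of _ "ricci A c D"])
    then show ?thesis
      by (simp add: nabla_up_def right_diff_distrib sum_subtractf)
  qed
  ultimately show ?thesis
    unfolding divergence_einstein[OF D.torsion_free_connection_axioms p] partial_ricci_scalar[OF p]
    by (simp add: field_simps)
qed

end

lemma dual_connections_in_chart:
  assumes "statistical_manifold A g D Ds" "c \<in> A"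
  shows "dual_connections A c g D Ds"
proof -
  have s: "smooth_structure A" "pseudo_riemannian_metric A g" "affine_connection A D"
    "dual_connection A g D Ds" "torsion_free A D" "torsion_free A Ds"
    using assms(1) by (simp_all add: statistical_manifold_def)
  interpret coordinate_chart A c using s assms(2) by unfold_locales
  show ?thesis
  proof unfold_locales
    show "pseudo_riemannian_metric A g" "affine_connection A D" "torsion_free A D"
      "torsion_free A Ds" "affine_connection A Ds"
      using s by (simp_all add: dual_connection_def)
    fix X Y Z p
    assume "smooth_field_on A U X" "smooth_field_on A U Y" "smooth_field_on A U Z" "p \<in> U"
    then show "X p (\<lambda>q. g q (Y q) (Z q)) = g p (D X Y p) (Z p) + g p (Y p) (Ds X Z p)"
      using s(4)[unfolded dual_connection_def, THEN conjunct2, rule_format, of U X Y Z p] open_U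
      by blast
  qed
qed

theorem theorem4p18:
  fixes A :: "('m::{t2_space, second_countable_topology}, 'n::finite) chart set"
    and g :: "'m \<Rightarrow> 'm tvec \<Rightarrow> 'm tvec \<Rightarrow> real"
    and D Ds :: "'m vfield \<Rightarrow> 'm vfield \<Rightarrow> 'm vfield"
    and c :: "('m, 'n) chart" and p :: 'm and j :: 'n
  assumes "statistical_manifold A g D Ds"
    and "c \<in> A" and "p \<in> dom_chart c"
  shows "((\<Sum>i\<in>UNIV. nabla_up A c g D i (einstein A c g D) i j p) =
      - 1/2 * (
        (\<Sum>i\<in>UNIV. nabla_up A c g D i (\<lambda>a b q. ricci A c Ds a b q - ricci A c D b a q) i j p)
        + (\<Sum>i\<in>UNIV. nabla_up A c g D i (metric_comp A c g) i j p) * ricci_scalar A c g D p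
        + (\<Sum>h\<in>UNIV. \<Sum>l\<in>UNIV. \<Sum>s\<in>UNIV.
             nabla_con A c D h (inv_metric_comp A c g) l s p * curv_comp A c D l h s j p)
        + (\<Sum>l\<in>UNIV. \<Sum>s\<in>UNIV.
             nabla_con A c D j (inv_metric_comp A c g) l s p * ricci A c D l s p)
        + (\<Sum>h\<in>UNIV. \<Sum>s\<in>UNIV.
             nabla_con A c D h (inv_metric_comp A c g) h s p * ricci A c Ds s j p)))
    \<and> ((\<Sum>i\<in>UNIV. nabla_up A c g Ds i (einstein A c g Ds) i j p) =
      - 1/2 * (
        (\<Sum>i\<in>UNIV. nabla_up A c g Ds i (\<lambda>a b q. ricci A c D a b q - ricci A c Ds b a q) i j p)
        + (\<Sum>i\<in>UNIV. nabla_up A c g Ds i (metric_comp A c g) i j p) * ricci_scalar A c g Ds p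
        + (\<Sum>h\<in>UNIV. \<Sum>l\<in>UNIV. \<Sum>s\<in>UNIV.
             nabla_con A c Ds h (inv_metric_comp A c g) l s p * curv_comp A c Ds l h s j p)
        + (\<Sum>l\<in>UNIV. \<Sum>s\<in>UNIV.
             nabla_con A c Ds j (inv_metric_comp A c g) l s p * ricci A c Ds l s p)
        + (\<Sum>h\<in>UNIV. \<Sum>s\<in>UNIV.
             nabla_con A c Ds h (inv_metric_comp A c g) h s p * ricci A c D s j p)))
    \<and> ((\<Sum>i\<in>UNIV. nabla_up A c g Ds i (einstein A c g D) i j p) =
      (\<Sum>i\<in>UNIV. nabla_up A c g Ds i (ricci_sym A c D) i j p)
      - 1/2 * (\<Sum>i\<in>UNIV. nabla_up A c g Ds i (metric_comp A c g) i j p) * ricci_scalar A c g D p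
      - 1/2 * nabla_scalar A c j (ricci_scalar A c g D) p)
    \<and> ((\<Sum>i\<in>UNIV. nabla_up A c g D i (einstein A c g Ds) i j p) =
      (\<Sum>i\<in>UNIV. nabla_up A c g D i (ricci_sym A c Ds) i j p)
      - 1/2 * (\<Sum>i\<in>UNIV. nabla_up A c g D i (metric_comp A c g) i j p) * ricci_scalar A c g Ds p
      - 1/2 * nabla_scalar A c j (ricci_scalar A c g Ds) p)"
proof -
  interpret S: dual_connections A c g D Ds
    by (rule dual_connections_in_chart[OF assms(1,2)])
  interpret S': dual_connections A c g Ds D by (rule S.dual_connections_swap)
  show ?thesis
    unfolding nabla_scalar_def
    by (intro conjI S.divergence_einstein_dual S'.divergence_einstein_dual S.divergence_einstein
        S'.divergence_einstein S.D.torsion_free_connection_axioms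
        S.Ds.torsion_free_connection_axioms assms(3))
qed

end
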